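(* Work in the setting and under the standing assumptions stated in the context. Let $g\in L^+_\infty(D\times V)$ with $\langle g,\tilde\varphi\rangle>0$ and $(r,\upsilon)\in D\times V$. For $\varepsilon>0$ there is a choice of $k,t$ (depending on $\varepsilon$) such that $$\mathbf{E}_{(r,\upsilon)}\Big[\big(\Psi^{\mathrm{rw}}_k[g](t,r,\upsilon)^{1/t}-e^{\lambda_*}\big)^2\Big]\le\varepsilon^2.\qquad(\star)$$ Moreover, $(\star)$ holds in the limit as $\varepsilon\to0$ with $$\mathbf{E}_{(r,\upsilon)}\big[\mathrm{Cost}(k,t)\big]\le C\exp\big((\lambda_1-2\lambda_* )\sqrt{\kappa_{[0]}}\,\varepsilon^{-1}\big)$$ for some $C>0$, and the optimal choice of $k,t$ corresponds to $t\approx\sqrt{\kappa_{[0]}}\,\varepsilon^{-1}$ and $k\approx(\lambda_1-2\lambda_* )\sqrt{\kappa_{[0]}}\,\tilde\kappa_{[1]}\,\varepsilon^{-3}\exp((\lambda_1-2\lambda_* )t)/2$.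
   Context: Domain and cross-sections. $D\subset\mathbb{R}^3$ is non-empty, open, smooth, bounded and convex; $V=\{\upsilon\in\mathbb{R}^3:\upsilon_{\min}\le|\upsilon|\le\upsilon_{\max}\}$ with $0<\upsilon_{\min}<\upsilon_{\max}<\infty$. $L^+_\infty(D\times V)$ is the set of non-negative bounded measurable functions on $D\times V$; $\langle f,g\rangle=\int_{D\times V}f g\,dr\,d\upsilon$. Measurable non-negative functions $\sigma_{\mathrm s}(r,\upsilon),\sigma_{\mathrm f}(r,\upsilon),\pi_{\mathrm s}(r,\upsilon,\upsilon'),\pi_{\mathrm f}(r,\upsilon,\upsilon')$ are given, with $\int_V\pi_{\mathrm s}(r,\upsilon,\upsilon')d\upsilon'=1$. Standing assumptions: all four functions are bounded; $\inf_{r\in D,\upsilon,\upsilon'\in V}(\sigma_{\mathrm s}(r,\upsilon)\pi_{\mathrm s}(r,\upsilon,\upsilon')+\sigma_{\mathrm f}(r,\upsilon)\pi_{\mathrm f}(r,\upsilon,\upsilon'))>0$; there is an open ball $B$ compactly embedded in $D$ with $\inf_{r\in B,\upsilon,\upsilon'\in V}\sigma_{\mathrm f}(r,\upsilon)\pi_{\mathrm f}(r,\upsilon,\upsilon')>0$; $\sup_{r,\upsilon}\int_V\pi_{\mathrm f}(r,\upsilon,\upsilon')d\upsilon'\le n_{\max}$ for a constant $n_{\max}>1$. Neutron random walk (NRW). Define a rate $\alpha$ and probability densities $\pi(r,\upsilon,\cdot)$ on $V$ by $\alpha(r,\upsilon)\pi(r,\upsilon,\upsilon')=\sigma_{\mathrm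 s}(r,\upsilon)\pi_{\mathrm s}(r,\upsilon,\upsilon')+\sigma_{\mathrm f}(r,\upsilon)\pi_{\mathrm f}(r,\upsilon,\upsilon')$. The $\alpha\pi$-NRW $(R_t,\Upsilon_t)_{t\ge0}$ moves in a straight line with its current velocity, scatters at rate $\alpha(R_t,\Upsilon_t)$ to a new velocity with density $\pi(R_t,\Upsilon_t,\cdot)$, and is killed at $\tau^D=\inf\{t>0:R_t\notin D\}$. Its law from $(r,\upsilon)$ is $\mathbf{P}_{(r,\upsilon)}$. Put $\beta(r,\upsilon)=\sigma_{\mathrm f}(r,\upsilon)(\int_V\pi_{\mathrm f}(r,\upsilon,\upsilon')d\upsilon'-1)$ and $\psi_t[g](r,\upsilon)=\mathbf{E}_{(r,\upsilon)}[e^{\int_0^t\beta(R_s,\Upsilon_s)ds}g(R_t,\Upsilon_t)\mathbf 1_{(t<\tau^D)}]$. Leading eigen-triple (known): there exist $\lambda_*\in\mathbb{R}$ and $\varphi,\tilde\varphi\in L^+_\infty(D\times V)$, with $\varphi$ positive, such that $\psi_t[\varphi]=e^{\lambda_*t}\varphi$, $\langle\tilde\varphi,\psi_t[g]\rangle=e^{\lambda_*t}\langle\tilde\varphi,g\rangle$, and for some $\epsilon_0>0$, $\sup_{\|g\|_\infty\le1}\|e^{-\lambda_*t}\varphi^{-1}\psi_t[g]-\langle\tilde\varphi,g\rangle\|_\infty=O(e^{-\epsilon_0t})$. The same result holds with $\beta$ replaced by $2\beta$; $\lambda_1$ denotes the resulting leading eigenvalue, i.e. that of the semigroup $g\mapsto\mathbf{E}_{(r,\upsilon)}[e^{\int_0^t2\beta(R_s,\Upsilon_s)ds}g(R_t,\Upsilon_t)\mathbf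 1_{(t<\tau^D)}]$. Estimator. $\Psi^{\mathrm{rw}}_k[g](t,r,\upsilon)=\frac1k\sum_{i=1}^ke^{\int_0^t\beta(R^i_s,\Upsilon^i_s)ds}g(R^i_t,\Upsilon^i_t)\mathbf 1_{(t<\tau^{D,i})}$, with $(R^i,\Upsilon^i)$ independent copies of the NRW under $\mathbf{P}_{(r,\upsilon)}$ with exit times $\tau^{D,i}$. Constants. $\tilde\kappa_{[1]},\kappa_{[0]}>0$ (depending on $g,r,\upsilon$) are constants such that the left side of $(\star)$ is at most $\tilde\kappa_{[1]}k^{-1}e^{(\lambda_1-2\lambda_* )t}+\kappa_{[0]}t^{-2}$ for all sufficiently large $t$. With $C_{[0]}=\langle\tilde\varphi,g\rangle\varphi(r,\upsilon)\neq1$ one takes $\kappa_{[0]}=2[\log(C_{[0]})e^{\lambda_*}]^2+\eta$ with $\eta>0$ arbitrary; $\kappa_{[0]}$ is thus specified only up to an arbitrarily small positive additive constant, and the exponential cost bound is read with this convention (polynomial factors in $\varepsilon^{-1}$ are absorbed by increasing $\kappa_{[0]}$ by an arbitrarily small fixed amount). Cost. $C_t[f]=\sum_jf(R_{t_j},\Upsilon_{t_j})\mathbf 1_{(t_j\le t)}$ with $t_0<t_1<\cdots$ the scatter times of $(R,\Upsilon)$; $\mathrm{Cost}(k,t)=k\times\sup_{f\in L^+_\infty(D\times V),\|f\|_\infty\le1}C_t[f]$. Optimality. "In the limit as $\varepsilon\to0$" means for all sufficiently small $\varepsilon$. "Optimal choice" means the minimiser of $k$ (to which the expected cost is proportional up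 to a bounded factor) over real $k,t>0$ subject to $\tilde\kappa_{[1]}k^{-1}e^{(\lambda_1-2\lambda_* )t}+\kappa_{[0]}t^{-2}\le\varepsilon^2$; "$\approx$" means equality to leading order as $\varepsilon\to0$, with $k$ expressed in terms of the optimal $t$. *)

theory Defs
  imports "HOL-Probability.Probability" "HOL-Library.Landau_Symbols"
begin

text \<open>Class \<open>C\<^sup>n\<close> on an open set \<open>U\<close>, by recursion on the partial derivatives.\<close>

primrec C_diff_on :: "nat \<Rightarrow> 'a::euclidean_space set \<Rightarrow> ('a \<Rightarrow> real) \<Rightarrow> bool" where
  "C_diff_on 0 U f \<longleftrightarrow> continuous_on U f"
| "C_diff_on (Suc n) U f \<longleftrightarrow>
     (\<forall>x\<in>U. f differentiable (at x)) \<and>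
     (\<forall>b\<in>Basis. C_diff_on n U (\<lambda>x. frechet_derivative f (at x) b))"

text \<open>Near each boundary point, \<open>D\<close> is a sublevel set of a \<open>C\<^sup>\<infinity>\<close> function with nonzero gradient there.\<close>

definition smooth_domain :: "'a::euclidean_space set \<Rightarrow> bool" where
  "smooth_domain D \<longleftrightarrow>
     (\<forall>p\<in>frontier D. \<exists>U \<rho>. open U \<and> p \<in> U \<and> (\<forall>n. C_diff_on n U \<rho>) \<and>
        (\<exists>h. frechet_derivative \<rho> (at p) h \<noteq> 0) \<and> D \<inter> U = {x\<in>U. \<rho> x < 0})"

type_synonym vec3 = "real ^ 3"
type_synonym phase = "vec3 \<times> vec3"

record transport =
  region :: "vec3 set"
  vmin :: real
  vmax :: real
  \<sigma>\<^sub>s :: "vec3 \<Rightarrow> vec3 \<Rightarrow> real"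
  \<sigma>\<^sub>f :: "vec3 \<Rightarrow> vec3 \<Rightarrow> real"
  \<pi>\<^sub>s :: "vec3 \<Rightarrow> vec3 \<Rightarrow> vec3 \<Rightarrow> real"
  \<pi>\<^sub>f :: "vec3 \<Rightarrow> vec3 \<Rightarrow> vec3 \<Rightarrow> real"

definition velocities :: "transport \<Rightarrow> vec3 set" where
  "velocities S = {v. vmin S \<le> norm v \<and> norm v \<le> vmax S}"

definition phase_space :: "transport \<Rightarrow> phase set" where
  "phase_space S = region S \<times> velocities S"

text \<open>
  The cross-sections, and all functions on the phase space \<open>D \<times> V\<close>, are total functions in HOL;
  their values off \<open>D \<times> V\<close> (respectively \<open>D \<times> V \<times> V\<close>) are unconstrained and irrelevant.
\<close>

definition transport_assms :: "transport \<Rightarrow> real \<Rightarrow> bool" where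
  "transport_assms S n_max \<longleftrightarrow>
     (let D = region S; V = velocities S in
      D \<noteq> {} \<and> open D \<and> smooth_domain D \<and> bounded D \<and> convex D \<and>
      0 < vmin S \<and> vmin S < vmax S \<and>
      (\<lambda>(r, v). \<sigma>\<^sub>s S r v) \<in> borel_measurable (restrict_space borel (D \<times> V)) \<and>
      (\<lambda>(r, v). \<sigma>\<^sub>f S r v) \<in> borel_measurable (restrict_space borel (D \<times> V)) \<and>
      (\<lambda>(r, v, v'). \<pi>\<^sub>s S r v v') \<in> borel_measurable (restrict_space borel (D \<times> V \<times> V)) \<and>
      (\<lambda>(r, v, v'). \<pi>\<^sub>f S r v v') \<in> borel_measurable (restrict_space borel (D \<times> V \<times> V)) \<and>
      (\<forall>r\<in>D. \<forall>v\<in>V. 0 \<le> \<sigma>\<^sub>s S r v \<and> 0 \<le> \<sigma>\<^sub>f S r v) \<and>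
      (\<forall>r\<in>D. \<forall>v\<in>V. \<forall>v'\<in>V. 0 \<le> \<pi>\<^sub>s S r v v' \<and> 0 \<le> \<pi>\<^sub>f S r v v') \<and>
      (\<forall>r\<in>D. \<forall>v\<in>V. (LINT v':V|lborel. \<pi>\<^sub>s S r v v') = 1) \<and>
      bounded ((\<lambda>(r, v). \<sigma>\<^sub>s S r v) ` (D \<times> V)) \<and>
      bounded ((\<lambda>(r, v). \<sigma>\<^sub>f S r v) ` (D \<times> V)) \<and>
      bounded ((\<lambda>(r, v, v'). \<pi>\<^sub>s S r v v') ` (D \<times> V \<times> V)) \<and>
      bounded ((\<lambda>(r, v, v'). \<pi>\<^sub>f S r v v') ` (D \<times> V \<times> V)) \<and>
      0 < (INF (r, v, v')\<in>D \<times> V \<times> V. \<sigma>\<^sub>s S r v * \<pi>\<^sub>s S r v v' + \<sigma>\<^sub>f S r v * \<pi>\<^sub>f S r v v') \<and>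
      (\<exists>c \<rho>. 0 < \<rho> \<and> cball c \<rho> \<subseteq> D \<and>
         0 < (INF (r, v, v')\<in>ball c \<rho> \<times> V \<times> V. \<sigma>\<^sub>f S r v * \<pi>\<^sub>f S r v v')) \<and>
      1 < n_max \<and>
      (\<forall>r\<in>D. \<forall>v\<in>V. (LINT v':V|lborel. \<pi>\<^sub>f S r v v') \<le> n_max))"

definition Linf_plus :: "transport \<Rightarrow> (phase \<Rightarrow> real) set" where
  "Linf_plus S = {g. g \<in> borel_measurable (restrict_space borel (phase_space S)) \<and>
     (\<forall>x\<in>phase_space S. 0 \<le> g x) \<and> bounded (g ` phase_space S)}"

definition Linf_plus_ball :: "transport \<Rightarrow> (phase \<Rightarrow> real) set" where
  "Linf_plus_ball S = {g \<in> Linf_plus S. \<forall>x\<in>phase_space S. \<bar>g x\<bar> \<le> 1}"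

definition pairing :: "transport \<Rightarrow> (phase \<Rightarrow> real) \<Rightarrow> (phase \<Rightarrow> real) \<Rightarrow> real" where
  "pairing S f g = (LINT x:phase_space S|lborel. f x * g x)"

text \<open>
  The scatter kernel vanishes off \<open>D \<times> V \<times> V\<close>: there is no scattering outside the domain.
  Since \<open>\<pi>(r, v, \<cdot>)\<close> has total mass one, \<open>\<alpha>(r, v)\<close> is the total mass of the kernel.
\<close>

definition scatter_kernel :: "transport \<Rightarrow> vec3 \<Rightarrow> vec3 \<Rightarrow> vec3 \<Rightarrow> real" where
  "scatter_kernel S r v v' =
     (if r \<in> region S \<and> v \<in> velocities S \<and> v' \<in> velocities S
      then \<sigma>\<^sub>s S r v * \<pi>\<^sub>s S r v v' + \<sigma>\<^sub>f S r v * \<pi>\<^sub>f S r v v' else 0)"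

definition scatter_rate :: "transport \<Rightarrow> vec3 \<Rightarrow> vec3 \<Rightarrow> real" where
  "scatter_rate S r v = (LINT v'|lborel. scatter_kernel S r v v')"

definition scatter_density :: "transport \<Rightarrow> vec3 \<Rightarrow> vec3 \<Rightarrow> vec3 \<Rightarrow> real" where
  "scatter_density S r v v' = scatter_kernel S r v v' / scatter_rate S r v"

definition \<beta> :: "transport \<Rightarrow> phase \<Rightarrow> real" where
  "\<beta> S = (\<lambda>(r, v). \<sigma>\<^sub>f S r v * ((LINT v':velocities S|lborel. \<pi>\<^sub>f S r v v') - 1))"

text \<open>
  A path is coded by its start \<open>x = (r, v)\<close> and a sequence of marks: \<open>z n\<close> is the duration of the
  \<open>n\<close>-th straight flight (infinite if it is never ended by a scatter) and the velocity taken at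
  its end. Marks after an infinite duration have no meaning. The point \<open>scatter_time z 0 = 0\<close>
  is the start; the scatters are at the finite times among \<open>scatter_time z (Suc j)\<close>.
\<close>

type_synonym marks = "nat \<Rightarrow> ennreal \<times> vec3"

definition scatter_time :: "marks \<Rightarrow> nat \<Rightarrow> ennreal" where
  "scatter_time z n = (\<Sum>i<n. fst (z i))"

definition flight_velocity :: "phase \<Rightarrow> marks \<Rightarrow> nat \<Rightarrow> vec3" where
  "flight_velocity x z n = (case n of 0 \<Rightarrow> snd x | Suc m \<Rightarrow> snd (z m))"

primrec flight_start :: "phase \<Rightarrow> marks \<Rightarrow> nat \<Rightarrow> vec3" where
  "flight_start x z 0 = fst x"
| "flight_start x z (Suc n) =
     flight_start x z n + enn2real (fst (z n)) *\<^sub>R flight_velocity x z n"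

definition scatter_count :: "marks \<Rightarrow> real \<Rightarrow> nat" where
  "scatter_count z t = card {n. scatter_time z (Suc n) \<le> ennreal t}"

definition position :: "phase \<Rightarrow> marks \<Rightarrow> real \<Rightarrow> vec3" where
  "position x z t = (let n = scatter_count z t in
     flight_start x z n + (t - enn2real (scatter_time z n)) *\<^sub>R flight_velocity x z n)"

definition velocity :: "phase \<Rightarrow> marks \<Rightarrow> real \<Rightarrow> vec3" where
  "velocity x z t = flight_velocity x z (scatter_count z t)"

definition exit_time :: "transport \<Rightarrow> phase \<Rightarrow> marks \<Rightarrow> ennreal" where
  "exit_time S x z = Inf {ennreal t | t. 0 < t \<and> position x z t \<notin> region S}"

text \<open>
  As usual, paths are taken to have positive flight durations, velocities in \<open>V\<close>, and
  finitely many scatters in bounded time; since the scatter rate is bounded, this only discards a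
  null set.
\<close>

definition path_space :: "transport \<Rightarrow> marks measure" where
  "path_space S = restrict_space (Pi\<^sub>M UNIV (\<lambda>_. borel))
     {z. (\<forall>n. 0 < fst (z n) \<and> snd (z n) \<in> velocities S) \<and>
         (\<forall>t. finite {n. scatter_time z n \<le> ennreal t})}"

text \<open>
  The law of the walk: given the first \<open>n\<close> marks, and if the \<open>n\<close>-th scatter occurs, at
  position \<open>y\<close> with outgoing velocity \<open>w\<close>, the next flight duration and the velocity
  after it have joint density
  \[ u, v' \mapsto \exp \Big(- \int_0^u \alpha(y + q w, w)\, dq\Big)\,
       \alpha(y + u w, w)\, \pi(y + u w, w, v') \]
  on \<open>[0, \<infinity>) \<times> V\<close>, the missing mass being that of an infinite duration.
\<close>

definition survival :: "transport \<Rightarrow> vec3 \<Rightarrow> vec3 \<Rightarrow> real \<Rightarrow> real" where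
  "survival S y w u = exp (- (LINT q:{0..u}|lborel. scatter_rate S (y + q *\<^sub>R w) w))"

definition next_mark_prob :: "transport \<Rightarrow> vec3 \<Rightarrow> vec3 \<Rightarrow> real \<Rightarrow> vec3 set \<Rightarrow> ennreal" where
  "next_mark_prob S y w s B =
     (\<integral>\<^sup>+u\<in>{0..s}. ennreal (survival S y w u * scatter_rate S (y + u *\<^sub>R w) w) *
        (\<integral>\<^sup>+v'\<in>B. ennreal (scatter_density S (y + u *\<^sub>R w) w v') \<partial>lborel) \<partial>lborel)"

definition nrw_law :: "transport \<Rightarrow> phase \<Rightarrow> marks measure \<Rightarrow> bool" where
  "nrw_law S x M \<longleftrightarrow> prob_space M \<and> sets M = sets (path_space S) \<and>
     (\<forall>n. \<forall>A\<in>sets (Pi\<^sub>M {..<n} (\<lambda>_. borel)). \<forall>s\<ge>0. \<forall>B\<in>sets borel.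
        (let E = {z\<in>space M. restrict z {..<n} \<in> A \<and> scatter_time z n < \<infinity>} in
         emeasure M {z\<in>E. fst (z n) \<le> ennreal s \<and> snd (z n) \<in> B} =
         (\<integral>\<^sup>+z\<in>E. next_mark_prob S (flight_start x z n) (flight_velocity x z n) s B \<partial>M)))"

definition weight ::
  "transport \<Rightarrow> (phase \<Rightarrow> real) \<Rightarrow> (phase \<Rightarrow> real) \<Rightarrow> real \<Rightarrow> phase \<Rightarrow> marks \<Rightarrow> real" where
  "weight S b g t x z =
     exp (LINT s:{0..t}|lborel. b (position x z s, velocity x z s)) *
     g (position x z t, velocity x z t) * of_bool (ennreal t < exit_time S x z)"

text \<open>Below, \<open>P\<close> is the family of laws \<open>\<^bold>P\<^bsub>(r,v)\<^esub>\<close>, and \<open>b\<close> is \<open>\<beta>\<close> or \<open>2\<beta>\<close>.\<close>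

definition semigroup_op ::
  "transport \<Rightarrow> (phase \<Rightarrow> marks measure) \<Rightarrow> (phase \<Rightarrow> real) \<Rightarrow> real \<Rightarrow> (phase \<Rightarrow> real) \<Rightarrow> phase \<Rightarrow> real"
where
  "semigroup_op S P b t g x = (\<integral>z. weight S b g t x z \<partial>P x)"

text \<open>
  The norm is the supremum over \<open>D \<times> V\<close>; the last clause is the \<open>O(exp (- \<epsilon>\<^sub>0 t))\<close> bound as
  \<open>t \<rightarrow> \<infinity>\<close>, uniform in \<open>g\<close> and \<open>x\<close>.
\<close>

definition leading_eigentriple ::
  "transport \<Rightarrow> (phase \<Rightarrow> marks measure) \<Rightarrow> (phase \<Rightarrow> real) \<Rightarrow>
   real \<Rightarrow> (phase \<Rightarrow> real) \<Rightarrow> (phase \<Rightarrow> real) \<Rightarrow> bool" where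
  "leading_eigentriple S P b lam \<phi> \<phi>' \<longleftrightarrow>
     \<phi> \<in> Linf_plus S \<and> \<phi>' \<in> Linf_plus S \<and> (\<forall>x\<in>phase_space S. 0 < \<phi> x) \<and>
     (\<forall>t\<ge>0. \<forall>x\<in>phase_space S. semigroup_op S P b t \<phi> x = exp (lam * t) * \<phi> x) \<and>
     (\<forall>t\<ge>0. \<forall>g\<in>Linf_plus S.
        pairing S \<phi>' (semigroup_op S P b t g) = exp (lam * t) * pairing S \<phi>' g) \<and>
     (\<exists>\<epsilon>\<^sub>0>0. \<exists>K t\<^sub>0. \<forall>t\<ge>t\<^sub>0. \<forall>g\<in>Linf_plus_ball S. \<forall>x\<in>phase_space S.
        \<bar>exp (- lam * t) * semigroup_op S P b t g x / \<phi> x - pairing S \<phi>' g\<bar>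
          \<le> K * exp (- \<epsilon>\<^sub>0 * t))"

definition estimator ::
  "transport \<Rightarrow> nat \<Rightarrow> (phase \<Rightarrow> real) \<Rightarrow> real \<Rightarrow> phase \<Rightarrow> (nat \<Rightarrow> marks) \<Rightarrow> real" where
  "estimator S k g t x \<omega> = (1 / real k) * (\<Sum>i<k. weight S (\<beta> S) g t x (\<omega> i))"

text \<open>The \<open>k\<close> independent copies of the walk are the coordinates of the product space.\<close>

definition mean_square_error ::
  "transport \<Rightarrow> (phase \<Rightarrow> marks measure) \<Rightarrow> (phase \<Rightarrow> real) \<Rightarrow> phase \<Rightarrow> real \<Rightarrow> nat \<Rightarrow> real \<Rightarrow> real"
where
  "mean_square_error S P g x lam k t =
     (\<integral>\<omega>. (estimator S k g t x \<omega> powr (1 / t) - exp lam)\<^sup>2 \<partial>Pi\<^sub>M {..<k} (\<lambda>_. P x))"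

text \<open>The cost counts the scatters before the walk is killed; the start, at time 0, is not one.\<close>

definition path_cost :: "transport \<Rightarrow> (phase \<Rightarrow> real) \<Rightarrow> real \<Rightarrow> phase \<Rightarrow> marks \<Rightarrow> ennreal" where
  "path_cost S f t x z =
     (\<Sum>j. let T = scatter_time z (Suc j) in
        if T \<le> ennreal t \<and> T < exit_time S x z
        then ennreal (f (position x z (enn2real T), velocity x z (enn2real T))) else 0)"

definition cost :: "transport \<Rightarrow> nat \<Rightarrow> real \<Rightarrow> phase \<Rightarrow> marks \<Rightarrow> ennreal" where
  "cost S k t x z = of_nat k * (SUP f\<in>Linf_plus_ball S. path_cost S f t x z)"

definition error_constants ::
  "transport \<Rightarrow> (phase \<Rightarrow> marks measure) \<Rightarrow> (phase \<Rightarrow> real) \<Rightarrow> phase \<Rightarrow> real \<Rightarrow> real \<Rightarrow>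
   real \<Rightarrow> real \<Rightarrow> bool" where
  "error_constants S P g x lam lam\<^sub>1 \<kappa>\<^sub>1 \<kappa>\<^sub>0 \<longleftrightarrow> 0 < \<kappa>\<^sub>1 \<and> 0 < \<kappa>\<^sub>0 \<and>
     (\<exists>t\<^sub>0. \<forall>t\<ge>t\<^sub>0. \<forall>k\<ge>1. mean_square_error S P g x lam k t
        \<le> \<kappa>\<^sub>1 / real k * exp ((lam\<^sub>1 - 2 * lam) * t) + \<kappa>\<^sub>0 / t\<^sup>2)"

text \<open>The optimisation problem, with growth exponent \<open>a = lam\<^sub>1 - 2 lam\<close> and real \<open>k\<close>.\<close>

definition feasible :: "real \<Rightarrow> real \<Rightarrow> real \<Rightarrow> real \<Rightarrow> real \<Rightarrow> real \<Rightarrow> bool" where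
  "feasible a \<kappa>\<^sub>1 \<kappa>\<^sub>0 \<epsilon> k t \<longleftrightarrow>
     0 < k \<and> 0 < t \<and> \<kappa>\<^sub>1 / k * exp (a * t) + \<kappa>\<^sub>0 / t\<^sup>2 \<le> \<epsilon>\<^sup>2"

definition optimal :: "real \<Rightarrow> real \<Rightarrow> real \<Rightarrow> real \<Rightarrow> real \<Rightarrow> real \<Rightarrow> bool" where
  "optimal a \<kappa>\<^sub>1 \<kappa>\<^sub>0 \<epsilon> k t \<longleftrightarrow> feasible a \<kappa>\<^sub>1 \<kappa>\<^sub>0 \<epsilon> k t \<and>
     (\<forall>k' t'. feasible a \<kappa>\<^sub>1 \<kappa>\<^sub>0 \<epsilon> k' t' \<longrightarrow> k \<le> k')"

end

theory Submission
  imports Defs "HOL-Real_Asymp.Real_Asymp"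
begin

text \<open>
  Write \<open>W\<close> for the weight of one walk at time \<open>t\<close> and \<open>m\<close> for its mean. As
  \<open>\<bar>y powr p - 1\<bar> \<le> \<bar>y - 1\<bar>\<close> for \<open>0 < p \<le> 1\<close>, the error of the \<open>t\<close>-th root of the sample mean is at most
  twice \<open>(m powr (1/t) / m)\<^sup>2\<close> times the variance of the sample mean, plus twice the bias
  \<open>(m powr (1/t) - exp lam)\<^sup>2\<close>. The eigen-triples for \<open>\<beta>\<close> and \<open>2 \<beta>\<close> describe \<open>m\<close> and the
  second moment of \<open>W\<close>, and the bias is of order \<open>1/t\<^sup>2\<close> because \<open>m powr (1/t)\<close> is
  \<open>exp (lam + ln C\<^sub>0 / t + o(1/t))\<close>.

  A flight in the bounded domain lasts at most \<open>diameter D / vmin\<close>, and within that time the next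
  scatter fails to occur with probability bounded below. So the number of scatters before exit
  has geometric tails: its mean is finite, which bounds the cost by a multiple of \<open>k\<close>, and the walk
  exits almost surely. The latter yields the strict inequality \<open>lam\<^sub>1 > 2 lam\<close>, without which no
  optimal choice exists.

  Minimising \<open>k\<close> amounts to maximising \<open>\<kappa>\<^sub>1 / k = (\<epsilon>\<^sup>2 - \<kappa>\<^sub>0 / t\<^sup>2) exp (- a t)\<close>. The critical point
  satisfies \<open>(t \<epsilon>)\<^sup>2 = \<kappa>\<^sub>0 + 2 \<kappa>\<^sub>0 / (a t)\<close>, which gives the asymptotics.
\<close>

section \<open>The optimal sample size\<close>

text \<open>Isolating \<open>k\<close> leaves a bound that depends on \<open>t\<close> alone, which
  reduces the two-variable problem to maximising one function of \<open>t\<close>.\<close>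

lemma feasible_iff:
  assumes "0 < \<kappa>\<^sub>1"
  shows "feasible a \<kappa>\<^sub>1 \<kappa>\<^sub>0 \<epsilon> k t \<longleftrightarrow>
    0 < k \<and> 0 < t \<and> \<kappa>\<^sub>1 / k \<le> (\<epsilon>\<^sup>2 - \<kappa>\<^sub>0 / t\<^sup>2) * exp (- a * t)"
proof -
  have "\<kappa>\<^sub>1 / k * exp (a * t) + \<kappa>\<^sub>0 / t\<^sup>2 \<le> \<epsilon>\<^sup>2 \<longleftrightarrow> \<kappa>\<^sub>1 / k \<le> (\<epsilon>\<^sup>2 - \<kappa>\<^sub>0 / t\<^sup>2) * exp (- a * t)"
  proof -
    have "(\<epsilon>\<^sup>2 - \<kappa>\<^sub>0 / t\<^sup>2) * exp (- a * t) = (\<epsilon>\<^sup>2 - \<kappa>\<^sub>0 / t\<^sup>2) / exp (a * t)"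
      by (simp add: exp_minus divide_inverse)
    then show ?thesis by (auto simp: pos_le_divide_eq)
  qed
  then show ?thesis unfolding feasible_def by blast
qed

text \<open>The constraint is tight at an optimum, since otherwise \<open>k\<close> could be
  lowered. A time with \<open>R \<epsilon> t' \<le> 0\<close> admits no \<open>k\<close> at all and
  cannot compete with the positive value \<open>\<kappa>\<^sub>1 / k\<close>.\<close>

lemma optimal_iff:
  fixes a \<kappa>\<^sub>1 \<kappa>\<^sub>0 \<epsilon> k t :: real
  assumes "0 < \<kappa>\<^sub>1" "0 < k"
  defines "R \<equiv> \<lambda>\<epsilon> t. (\<epsilon>\<^sup>2 - \<kappa>\<^sub>0 / t\<^sup>2) * exp (- a * t)"
  shows "optimal a \<kappa>\<^sub>1 \<kappa>\<^sub>0 \<epsilon> k t \<longleftrightarrow> 0 < t \<and> \<kappa>\<^sub>1 / k = R \<epsilon> t \<and> (\<forall>t'>0. R \<epsilon> t' \<le> R \<epsilon> t)"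
proof
  assume opt: "optimal a \<kappa>\<^sub>1 \<kappa>\<^sub>0 \<epsilon> k t"
  then have t: "0 < t" and le: "\<kappa>\<^sub>1 / k \<le> R \<epsilon> t"
    by (auto simp: optimal_def feasible_iff[OF assms(1)] R_def)
  have ge: "R \<epsilon> t' \<le> \<kappa>\<^sub>1 / k" if "0 < t'" for t'
  proof (cases "0 < R \<epsilon> t'")
    case True
    then have "feasible a \<kappa>\<^sub>1 \<kappa>\<^sub>0 \<epsilon> (\<kappa>\<^sub>1 / R \<epsilon> t') t'"
      using that assms(1) by (simp add: feasible_iff R_def)
    then have "k \<le> \<kappa>\<^sub>1 / R \<epsilon> t'" using opt by (auto simp: optimal_def)
    then show ?thesis using True assms(2) by (simp add: field_simps)
  next
    case False
    moreover have "0 < \<kappa>\<^sub>1 / k" using assms by simp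
    ultimately show ?thesis by linarith
  qed
  from ge[OF t] le have "\<kappa>\<^sub>1 / k = R \<epsilon> t" by simp
  with ge t show "0 < t \<and> \<kappa>\<^sub>1 / k = R \<epsilon> t \<and> (\<forall>t'>0. R \<epsilon> t' \<le> R \<epsilon> t)" by simp
next
  assume R: "0 < t \<and> \<kappa>\<^sub>1 / k = R \<epsilon> t \<and> (\<forall>t'>0. R \<epsilon> t' \<le> R \<epsilon> t)"
  have "k \<le> k'" if "feasible a \<kappa>\<^sub>1 \<kappa>\<^sub>0 \<epsilon> k' t'" for k' t'
  proof -
    have "0 < k'" "0 < t'" "\<kappa>\<^sub>1 / k' \<le> R \<epsilon> t'"
      using that by (auto simp: feasible_iff[OF assms(1)] R_def)
    moreover from this R have "\<kappa>\<^sub>1 / k' \<le> \<kappa>\<^sub>1 / k" by (metis order_trans)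
    ultimately show ?thesis using assms(1,2) by (simp add: field_simps)
  qed
  with R assms show "optimal a \<kappa>\<^sub>1 \<kappa>\<^sub>0 \<epsilon> k t"
    by (auto simp: optimal_def feasible_iff R_def)
qed

text \<open>\<open>R\<close> is nonpositive up to its zero \<open>t\<^sub>0\<close>, positive at
  \<open>2 * t\<^sub>0\<close>, and eventually below that value. Its maximum over a compact interval
  is therefore its maximum over all positive times.\<close>

lemma ex_optimal:
  assumes "0 < a" "0 < \<kappa>\<^sub>1" "0 < \<kappa>\<^sub>0" "0 < \<epsilon>"
  shows "\<exists>k t. optimal a \<kappa>\<^sub>1 \<kappa>\<^sub>0 \<epsilon> k t"
proof -
  define R where "R t = (\<epsilon>\<^sup>2 - \<kappa>\<^sub>0 / t\<^sup>2) * exp (- a * t)" for t :: real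
  define t\<^sub>0 where "t\<^sub>0 = sqrt \<kappa>\<^sub>0 / \<epsilon>"
  have t\<^sub>0: "0 < t\<^sub>0" and sq: "\<kappa>\<^sub>0 = \<epsilon>\<^sup>2 * t\<^sub>0\<^sup>2" using assms by (auto simp: t\<^sub>0_def power_divide)
  have pos: "0 < R (2 * t\<^sub>0)"
    unfolding R_def using sq t\<^sub>0 assms by (simp add: field_simps)
  have nonpos: "R t \<le> 0" if "0 < t" "t \<le> t\<^sub>0" for t
  proof -
    have "t\<^sup>2 \<le> t\<^sub>0\<^sup>2" using that by (simp add: power_mono)
    then have "\<epsilon>\<^sup>2 \<le> \<kappa>\<^sub>0 / t\<^sup>2"
      using that sq by (simp add: le_divide_eq mult_left_mono)
    then show ?thesis by (simp add: R_def mult_le_0_iff)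
  qed
  have "((\<lambda>t. \<epsilon>\<^sup>2 * exp (- a * t)) \<longlongrightarrow> 0) at_top"
    using assms(1) by real_asymp
  then have "\<forall>\<^sub>F t in at_top. \<epsilon>\<^sup>2 * exp (- a * t) < R (2 * t\<^sub>0)"
    using pos by (rule order_tendstoD)
  then obtain T where T: "\<And>t. T \<le> t \<Longrightarrow> \<epsilon>\<^sup>2 * exp (- a * t) < R (2 * t\<^sub>0)"
    by (auto simp: eventually_at_top_linorder)
  \<comment> \<open>The maximum keeps the reference point \<open>2 * t\<^sub>0\<close> inside the
    compact interval.\<close>
  define T' where "T' = max T (2 * t\<^sub>0)"
  have tail: "R t < R (2 * t\<^sub>0)" if "T' \<le> t" for t
  proof -
    have "R t \<le> \<epsilon>\<^sup>2 * exp (- a * t)" using assms by (simp add: R_def)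
    with T[of t] that show ?thesis by (simp add: T'_def)
  qed
  have "continuous_on {t\<^sub>0..T'} R"
    unfolding R_def using t\<^sub>0 by (auto intro!: continuous_intros)
  moreover have "compact {t\<^sub>0..T'}" "{t\<^sub>0..T'} \<noteq> {}" using t\<^sub>0 by (auto simp: T'_def)
  ultimately obtain t where t: "t \<in> {t\<^sub>0..T'}" "\<And>s. s \<in> {t\<^sub>0..T'} \<Longrightarrow> R s \<le> R t"
    using continuous_attains_sup by metis
  have Rt: "R (2 * t\<^sub>0) \<le> R t" using t t\<^sub>0 by (auto simp: T'_def)
  have "R s \<le> R t" if "0 < s" for s
    using t(2)[of s] nonpos[of s] tail[of s] Rt pos that by fastforce
  then have "optimal a \<kappa>\<^sub>1 \<kappa>\<^sub>0 \<epsilon> (\<kappa>\<^sub>1 / R t) t"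
    using assms t t\<^sub>0 Rt pos by (subst optimal_iff) (auto simp: R_def)
  then show ?thesis by blast
qed

text \<open>The derivative of \<open>R\<close> vanishes at the maximiser. This fixes
  \<open>\<epsilon>\<^sup>2 - \<kappa>\<^sub>0 / t\<^sup>2\<close> as a function of
  \<open>t\<close>, so that \<epsilon> drops out of the formula for \<open>k\<close>.\<close>

lemma optimal_critical:
  assumes "0 < a" "0 < \<kappa>\<^sub>1" "0 < \<kappa>\<^sub>0" "optimal a \<kappa>\<^sub>1 \<kappa>\<^sub>0 \<epsilon> k t"
  shows "0 < t" "(t * \<epsilon>)\<^sup>2 = \<kappa>\<^sub>0 + 2 * \<kappa>\<^sub>0 / (a * t)" "k = \<kappa>\<^sub>1 * a * t ^ 3 * exp (a * t) / (2 * \<kappa>\<^sub>0)"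
proof -
  define R where "R t = (\<epsilon>\<^sup>2 - \<kappa>\<^sub>0 / t\<^sup>2) * exp (- a * t)" for t :: real
  have "0 < k" using assms by (auto simp: optimal_def feasible_def)
  with assms have R: "0 < t" "\<kappa>\<^sub>1 / k = R t" "\<And>t'. 0 < t' \<Longrightarrow> R t' \<le> R t"
    by (auto simp: optimal_iff R_def)
  then show t: "0 < t" by simp
  have "(R has_real_derivative
     (2 * \<kappa>\<^sub>0 / t ^ 3 - a * (\<epsilon>\<^sup>2 - \<kappa>\<^sub>0 / t\<^sup>2)) * exp (- a * t)) (at t)"
    unfolding R_def using t
    by (auto intro!: derivative_eq_intros simp: field_simps power2_eq_square power3_eq_cube eval_nat_numeral)
  \<comment> \<open>With radius \<open>t\<close>, the neighbourhood in
    \<open>DERIV_local_max\<close> contains only positive times, where \<open>R\<close> is known to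
    be at most \<open>R t\<close>.\<close>
  then have "(2 * \<kappa>\<^sub>0 / t ^ 3 - a * (\<epsilon>\<^sup>2 - \<kappa>\<^sub>0 / t\<^sup>2)) * exp (- a * t) = 0"
    by (rule DERIV_local_max[OF _ t]) (use R(3) in auto)
  then have "2 * \<kappa>\<^sub>0 / t ^ 3 = a * (\<epsilon>\<^sup>2 - \<kappa>\<^sub>0 / t\<^sup>2)" by simp
  then have "\<epsilon>\<^sup>2 - \<kappa>\<^sub>0 / t\<^sup>2 = 2 * \<kappa>\<^sub>0 / t ^ 3 / a"
    using assms(1) by (simp add: eq_divide_eq mult.commute)
  then have crit: "\<epsilon>\<^sup>2 - \<kappa>\<^sub>0 / t\<^sup>2 = 2 * \<kappa>\<^sub>0 / (a * t ^ 3)"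
    by (simp add: mult.commute)
  have "(t * \<epsilon>)\<^sup>2 - \<kappa>\<^sub>0 = t\<^sup>2 * (\<epsilon>\<^sup>2 - \<kappa>\<^sub>0 / t\<^sup>2)"
    using t by (simp add: power_mult_distrib right_diff_distrib)
  also have "\<dots> = 2 * \<kappa>\<^sub>0 / (a * t)"
    unfolding crit using t by (simp add: power2_eq_square power3_eq_cube)
  finally show "(t * \<epsilon>)\<^sup>2 = \<kappa>\<^sub>0 + 2 * \<kappa>\<^sub>0 / (a * t)" by simp
  have "k = \<kappa>\<^sub>1 / R t" using R(2) \<open>0 < k\<close> assms(2) by (auto simp: field_simps)
  also have "\<dots> = \<kappa>\<^sub>1 * a * t ^ 3 * exp (a * t) / (2 * \<kappa>\<^sub>0)"
    unfolding R_def crit by (simp add: exp_minus field_simps)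
  finally show "k = \<kappa>\<^sub>1 * a * t ^ 3 * exp (a * t) / (2 * \<kappa>\<^sub>0)" .
qed

text \<open>The critical equation says that the ratio \<open>s\<close> of \<open>t\<close> to its
  leading order satisfies \<open>(s \<epsilon>)\<^sup>2 = 1 + 2 / (a * t \<epsilon>)\<close>. As
  \<open>t\<close> exceeds its leading order by about \<open>1 / a\<close>, the exponential has to
  keep the actual time; the remaining factors of \<open>k\<close> contribute exactly
  \<open>s \<epsilon> ^ 3\<close>.\<close>

lemma optimal_asymp:
  assumes "0 < a" "0 < \<kappa>\<^sub>1" "0 < \<kappa>\<^sub>0"
    and opt: "\<forall>\<^sub>F \<epsilon> in at_right 0. optimal a \<kappa>\<^sub>1 \<kappa>\<^sub>0 \<epsilon> (k \<epsilon>) (t \<epsilon>)"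
  shows "t \<sim>[at_right 0] (\<lambda>\<epsilon>. sqrt \<kappa>\<^sub>0 / \<epsilon>)"
    and "k \<sim>[at_right 0] (\<lambda>\<epsilon>. a * sqrt \<kappa>\<^sub>0 * \<kappa>\<^sub>1 * exp (a * t \<epsilon>) / (2 * \<epsilon> ^ 3))"
proof -
  have pos: "\<forall>\<^sub>F \<epsilon> in at_right (0::real). 0 < \<epsilon>" by (simp add: eventually_at_right_less)
  define s where "s \<epsilon> = t \<epsilon> * \<epsilon> / sqrt \<kappa>\<^sub>0" for \<epsilon>
  have crit: "\<forall>\<^sub>F \<epsilon> in at_right 0. 1 \<le> s \<epsilon> \<and> s \<epsilon> \<le> 1 + 2 / (a * sqrt \<kappa>\<^sub>0) * \<epsilon>"
    using opt pos
  proof eventually_elim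
    case (elim \<epsilon>)
    note t = optimal_critical[OF assms(1-3) elim(1)]
    define q where "q = 2 / (a * t \<epsilon>)"
    have q: "0 < q" using t(1) assms(1) by (simp add: q_def)
    have sq: "(s \<epsilon>)\<^sup>2 = 1 + q"
      using t(2) assms by (simp add: s_def power_divide q_def field_simps)
    have "0 < s \<epsilon>" using t(1) elim(2) assms by (simp add: s_def)
    with sq q have 1: "1 \<le> s \<epsilon>"
      by (smt (verit, best) power_le_one)
    \<comment> \<open>In \<open>q * s \<epsilon>\<close> the unknown time cancels, so this yields a
      bound linear in \<epsilon> without any prior lower bound on
      \<open>t \<epsilon>\<close>.\<close>
    have "q * 1 \<le> q * s \<epsilon>" using q 1 by (intro mult_left_mono) auto
    also have "\<dots> = 2 / (a * sqrt \<kappa>\<^sub>0) * \<epsilon>"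
      using t(1) assms by (simp add: q_def s_def)
    finally have "q \<le> 2 / (a * sqrt \<kappa>\<^sub>0) * \<epsilon>" by simp
    moreover have "s \<epsilon> \<le> (s \<epsilon>)\<^sup>2" using 1 by (simp add: power2_eq_square)
    ultimately show ?case using 1 sq by simp
  qed
  have s1: "(s \<longlongrightarrow> 1) (at_right 0)"
  proof (rule tendsto_sandwich)
    show "\<forall>\<^sub>F \<epsilon> in at_right 0. 1 \<le> s \<epsilon>" using crit by eventually_elim simp
    show "\<forall>\<^sub>F \<epsilon> in at_right 0. s \<epsilon> \<le> 1 + 2 / (a * sqrt \<kappa>\<^sub>0) * \<epsilon>" using crit by eventually_elim simp
    show "((\<lambda>\<epsilon>. 1 + 2 / (a * sqrt \<kappa>\<^sub>0) * \<epsilon>) \<longlongrightarrow> 1) (at_right 0)"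
      by (rule tendsto_eq_intros | simp)+
  qed simp
  show "t \<sim>[at_right 0] (\<lambda>\<epsilon>. sqrt \<kappa>\<^sub>0 / \<epsilon>)"
    by (rule asymp_equivI') (use s1 in \<open>simp add: s_def [abs_def]\<close>)
  have "((\<lambda>\<epsilon>. s \<epsilon> ^ 3) \<longlongrightarrow> 1) (at_right 0)" using tendsto_power[OF s1, of 3] by simp
  moreover have "\<forall>\<^sub>F \<epsilon> in at_right 0.
      k \<epsilon> / (a * sqrt \<kappa>\<^sub>0 * \<kappa>\<^sub>1 * exp (a * t \<epsilon>) / (2 * \<epsilon> ^ 3)) = s \<epsilon> ^ 3"
    using opt pos
  proof eventually_elim
    case (elim \<epsilon>)
    note t = optimal_critical[OF assms(1-3) elim(1)]
    have "sqrt \<kappa>\<^sub>0 ^ 3 = sqrt \<kappa>\<^sub>0 * \<kappa>\<^sub>0" using assms by (simp add: power3_eq_cube)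
    then show ?case
      using assms elim(2) unfolding t(3) s_def by (simp add: field_simps)
  qed
  ultimately show "k \<sim>[at_right 0] (\<lambda>\<epsilon>. a * sqrt \<kappa>\<^sub>0 * \<kappa>\<^sub>1 * exp (a * t \<epsilon>) / (2 * \<epsilon> ^ 3))"
    by (intro asymp_equivI') (simp add: filterlim_cong)
qed

text \<open>Taking \<open>t = sqrt \<kappa>' / \<epsilon>\<close> with \<open>\<kappa>'\<close>
  strictly between \<open>\<kappa>\<^sub>0\<close> and \<open>\<kappa>\<^sub>0 + \<delta>\<close>
  leaves room twice: the bias uses only a fraction of \<open>\<epsilon>\<^sup>2\<close>, and the gap
  \<open>c\<close> in the exponent outweighs the polynomial factor in \<open>k\<close>.\<close>

lemma sample_size_bound:
  fixes a \<kappa>\<^sub>1 \<kappa>\<^sub>0 \<delta> t\<^sub>0 :: real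
  assumes "0 < a" "0 < \<kappa>\<^sub>1" "0 < \<kappa>\<^sub>0" "0 < \<delta>"
  shows "\<forall>\<^sub>F \<epsilon> in at_right 0. \<exists>k\<ge>1. \<exists>t>0. t\<^sub>0 \<le> t \<and>
    \<kappa>\<^sub>1 / real k * exp (a * t) + \<kappa>\<^sub>0 / t\<^sup>2 \<le> \<epsilon>\<^sup>2 \<and> real k \<le> exp (a * sqrt (\<kappa>\<^sub>0 + \<delta>) / \<epsilon>)"
proof -
  define \<kappa>' where "\<kappa>' = \<kappa>\<^sub>0 + \<delta> / 2"
  \<comment> \<open>The bias takes the share \<open>\<kappa>\<^sub>0 / \<kappa>'\<close> of
    \<open>\<epsilon>\<^sup>2\<close>. This \<open>A\<close> makes the sample size
    \<open>A / \<epsilon>\<^sup>2 * exp (a * t)\<close> spend exactly the rest.\<close>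
  define A where "A = \<kappa>\<^sub>1 * \<kappa>' / (\<delta> / 2)"
  define c where "c = a * (sqrt (\<kappa>\<^sub>0 + \<delta>) - sqrt \<kappa>')"
  have \<kappa>': "0 < \<kappa>'" "\<kappa>' < \<kappa>\<^sub>0 + \<delta>" using assms by (auto simp: \<kappa>'_def)
  have A: "0 < A" using assms \<kappa>' by (simp add: A_def)
  have c: "0 < c" using assms \<kappa>' by (simp add: c_def)
  have "((\<lambda>\<epsilon>. (A / \<epsilon>\<^sup>2 + 1) * exp (- (c / \<epsilon>))) \<longlongrightarrow> 0) (at_right 0)"
    using c A by real_asymp
  then have ev: "\<forall>\<^sub>F \<epsilon> in at_right 0. (A / \<epsilon>\<^sup>2 + 1) * exp (- (c / \<epsilon>)) < 1"
    by (rule order_tendstoD) simp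
  have "filterlim (\<lambda>\<epsilon>. sqrt \<kappa>' / \<epsilon>) at_top (at_right 0)"
    using \<kappa>' by real_asymp
  then have "\<forall>\<^sub>F \<epsilon> in at_right 0. t\<^sub>0 \<le> sqrt \<kappa>' / \<epsilon>"
    by (auto simp: filterlim_at_top)
  moreover have "\<forall>\<^sub>F \<epsilon> in at_right (0::real). 0 < \<epsilon>" by (simp add: eventually_at_right_less)
  ultimately show ?thesis using ev
  proof eventually_elim
    case (elim \<epsilon>)
    define t where "t = sqrt \<kappa>' / \<epsilon>"
    define q where "q = A / \<epsilon>\<^sup>2 * exp (a * t)"
    define k where "k = nat \<lceil>q\<rceil>"
    have t: "0 < t" using elim \<kappa>' by (simp add: t_def)
    have q: "0 < q" using A elim by (simp add: q_def)
    have k: "1 \<le> k" "q \<le> real k" "real k \<le> q + 1" using q unfolding k_def by linarith+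
    have "\<kappa>\<^sub>1 / real k * exp (a * t) \<le> \<kappa>\<^sub>1 / q * exp (a * t)"
      using k q assms by (intro mult_right_mono divide_left_mono) auto
    also have "\<dots> = \<epsilon>\<^sup>2 * (\<delta> / 2 / \<kappa>')" using assms \<kappa>' by (simp add: q_def A_def mult.commute)
    finally have "\<kappa>\<^sub>1 / real k * exp (a * t) + \<kappa>\<^sub>0 / t\<^sup>2 \<le> \<epsilon>\<^sup>2 * (\<delta> / 2 / \<kappa>') + \<epsilon>\<^sup>2 * (\<kappa>\<^sub>0 / \<kappa>')"
      using \<kappa>' elim by (simp add: t_def power_divide mult.commute)
    also have "\<dots> = \<epsilon>\<^sup>2 * ((\<delta> / 2 + \<kappa>\<^sub>0) / \<kappa>')"
      by (simp only: add_divide_distrib distrib_left)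
    also have "\<dots> = \<epsilon>\<^sup>2" using \<kappa>' by (simp add: \<kappa>'_def add.commute)
    finally have err: "\<kappa>\<^sub>1 / real k * exp (a * t) + \<kappa>\<^sub>0 / t\<^sup>2 \<le> \<epsilon>\<^sup>2" .
    \<comment> \<open>Rounding up to an integer adds at most 1, which is absorbed as another
      \<open>exp (a * t)\<close>.\<close>
    have "1 \<le> exp (a * t)" using assms t by simp
    with k(3) have "real k \<le> A / \<epsilon>\<^sup>2 * exp (a * t) + exp (a * t)" unfolding q_def by linarith
    then have "real k \<le> (A / \<epsilon>\<^sup>2 + 1) * exp (a * t)" by (simp only: distrib_right mult_1)
    also have "exp (a * t) = exp (- (c / \<epsilon>)) * exp (a * sqrt (\<kappa>\<^sub>0 + \<delta>) / \<epsilon>)"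
      unfolding exp_add[symmetric] using elim by (simp add: t_def c_def field_simps)
    also have "(A / \<epsilon>\<^sup>2 + 1) * (exp (- (c / \<epsilon>)) * exp (a * sqrt (\<kappa>\<^sub>0 + \<delta>) / \<epsilon>))
        \<le> 1 * exp (a * sqrt (\<kappa>\<^sub>0 + \<delta>) / \<epsilon>)"
      unfolding mult.assoc[symmetric] using elim by (intro mult_right_mono) auto
    finally have "real k \<le> exp (a * sqrt (\<kappa>\<^sub>0 + \<delta>) / \<epsilon>)" by simp
    with k(1) t err elim(1) show ?case unfolding t_def[symmetric] by blast
  qed
qed

section \<open>Roots of sample means\<close>

text \<open>For such exponents \<open>y powr p\<close> lies between 1 and \<open>y\<close>.\<close>

lemma abs_powr_minus_one_le:
  fixes y p :: real
  assumes "0 \<le> y" "0 < p" "p \<le> 1"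
  shows "\<bar>y powr p - 1\<bar> \<le> \<bar>y - 1\<bar>"
proof (cases "1 \<le> y")
  case True
  then show ?thesis
    using powr_mono[of p 1 y] assms ge_one_powr_ge_zero[of y p] by simp
next
  case False
  moreover have "y \<le> y powr p"
    using powr_mono'[of p 1 y] assms False by (cases "y = 0") auto
  moreover have "y powr p \<le> 1" using False assms powr_mono2[of p y 1] by simp
  ultimately show ?thesis by simp
qed

text \<open>For negative \<open>y\<close> the upper bound comes from
  \<open>exp (- y) \<ge> 1 - y\<close> by taking reciprocals.\<close>

lemma abs_exp_minus_one_minus_le:
  fixes y :: real
  assumes "\<bar>y\<bar> \<le> 1"
  shows "\<bar>exp y - 1 - y\<bar> \<le> y\<^sup>2"
proof (cases "0 \<le> y")
  case True
  then show ?thesis using exp_bound[of y] exp_ge_add_one_self[of y] assms by linarith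
next
  case False
  have "exp y \<ge> 1 + y" by simp
  moreover have "exp y \<le> 1 / (1 - y)"
    using exp_ge_add_one_self[of "- y"] False by (simp add: exp_minus field_simps)
  moreover have "1 / (1 - y) \<le> 1 + y + y\<^sup>2"
  proof -
    have "(1 + y + y\<^sup>2) * (1 - y) = 1 + (- y) * y\<^sup>2" by (simp add: algebra_simps power2_eq_square)
    moreover have "0 \<le> (- y) * y\<^sup>2" using False by (intro mult_nonneg_nonneg) auto
    ultimately have "1 \<le> (1 + y + y\<^sup>2) * (1 - y)" by linarith
    then show ?thesis using False by (simp add: divide_le_eq)
  qed
  ultimately show ?thesis by linarith
qed

text \<open>This gives the exact \<open>1 / t\<close> coefficient of the bias, with \<open>m\<close>
  the mean weight. The root is \<open>exp lam * exp (y t)\<close> with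
  \<open>y t = ln (c t) / t\<close> tending to 0, and \<open>t * (exp (y t) - 1)\<close> has the
  same limit as \<open>t * y t = ln (c t)\<close>.\<close>

lemma powr_root_asymp:
  fixes c m :: "real \<Rightarrow> real"
  assumes "0 < C" and c: "(c \<longlongrightarrow> C) at_top"
    and m: "\<forall>\<^sub>F t in at_top. m t = exp (lam * t) * c t"
  shows "((\<lambda>t. t * (m t powr (1 / t) - exp lam)) \<longlongrightarrow> ln C * exp lam) at_top"
proof -
  define y where "y t = ln (c t) / t" for t
  have ln: "((\<lambda>t. ln (c t)) \<longlongrightarrow> ln C) at_top" using c assms(1) by (intro tendsto_intros) auto
  have y0: "(y \<longlongrightarrow> 0) at_top"
    unfolding y_def using ln by (intro tendsto_divide_0[OF ln]) (rule filterlim_at_top_imp_at_infinity, rule filterlim_ident)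
  have ty: "\<forall>\<^sub>F t in at_top. ln (c t) = t * y t"
    using eventually_gt_at_top[of 0] by eventually_elim (simp add: y_def)
  have "\<forall>\<^sub>F t in at_top. \<bar>y t\<bar> < 1"
    using tendsto_rabs[OF y0] by (intro order_tendstoD[of "\<lambda>t. \<bar>y t\<bar>"]) auto
  \<comment> \<open>The quadratic remainder \<open>t * (y t)\<^sup>2\<close> is written as a bounded
    factor times the vanishing factor \<open>\<bar>y t\<bar>\<close>.\<close>
  then have bd: "\<forall>\<^sub>F t in at_top. norm (t * (exp (y t) - 1) - ln (c t)) \<le> \<bar>ln (c t)\<bar> * \<bar>y t\<bar>"
    using ty eventually_gt_at_top[of 0]
  proof eventually_elim
    case (elim t)
    have "t * (exp (y t) - 1) - ln (c t) = t * (exp (y t) - 1 - y t)" using elim by (simp add: algebra_simps)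
    then have "norm (t * (exp (y t) - 1) - ln (c t)) = t * \<bar>exp (y t) - 1 - y t\<bar>"
      using elim by (simp add: abs_mult)
    also have "\<dots> \<le> t * (y t)\<^sup>2" using abs_exp_minus_one_minus_le[of "y t"] elim by simp
    also have "\<dots> = \<bar>ln (c t)\<bar> * \<bar>y t\<bar>" using elim by (simp add: abs_mult power2_eq_square)
    finally show ?case .
  qed
  have "((\<lambda>t. \<bar>ln (c t)\<bar> * \<bar>y t\<bar>) \<longlongrightarrow> \<bar>ln C\<bar> * \<bar>0\<bar>) at_top"
    by (intro tendsto_mult tendsto_rabs ln y0)
  then have "((\<lambda>t. t * (exp (y t) - 1) - ln (c t)) \<longlongrightarrow> 0) at_top"
    by (intro Lim_null_comparison[OF bd]) simp
  from tendsto_mult[OF tendsto_add[OF this ln] tendsto_const[of "exp lam"]]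
  have "((\<lambda>t. t * (exp (y t) - 1) * exp lam) \<longlongrightarrow> ln C * exp lam) at_top" by simp
  moreover have "\<forall>\<^sub>F t in at_top. t * (exp (y t) - 1) * exp lam = t * (m t powr (1 / t) - exp lam)"
    using m eventually_gt_at_top[of 0] order_tendstoD(1)[OF c assms(1)]
  proof eventually_elim
    case (elim t)
    have "m t = exp (lam * t + ln (c t))" using elim by (simp add: exp_add)
    then have "m t powr (1 / t) = exp ((lam * t + ln (c t)) / t)" by (simp add: powr_def)
    also have "\<dots> = exp lam * exp (y t)"
      using elim by (simp add: exp_add[symmetric] y_def add_divide_distrib)
    finally show ?case by (simp add: algebra_simps)
  qed
  ultimately show ?thesis by (rule Lim_transform_eventually)
qed

text \<open>Expanding the square of the centred sum, independence kills the off-diagonal terms and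
  leaves \<open>k\<close> variances; a variance is at most the second moment.\<close>

lemma (in prob_space) sample_mean_square:
  fixes W :: "'a \<Rightarrow> real" and k :: nat
  assumes W: "integrable M W" and W2: "integrable M (\<lambda>z. (W z)\<^sup>2)" and k: "1 \<le> k"
  defines "err \<equiv> \<lambda>\<omega>. ((1 / real k) * (\<Sum>i<k. W (\<omega> i)) - expectation W)\<^sup>2"
  shows "integrable (Pi\<^sub>M {..<k} (\<lambda>_. M)) err"
    and "integral\<^sup>L (Pi\<^sub>M {..<k} (\<lambda>_. M)) err \<le> expectation (\<lambda>z. (W z)\<^sup>2) / k"
proof -
  interpret P: product_prob_space "\<lambda>_. M" "{..<k}" ..
  define m where "m = expectation W"
  define Y where "Y z = W z - m" for z
  have Y: "integrable M Y" unfolding Y_def using W by simp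
  have Y0: "expectation Y = 0" unfolding Y_def using W by (simp add: m_def prob_space)
  have Y2: "integrable M (\<lambda>z. (Y z)\<^sup>2)"
    unfolding Y_def power2_diff using W W2 by simp
  have "expectation (\<lambda>z. (Y z)\<^sup>2) = expectation (\<lambda>z. (W z)\<^sup>2) - m\<^sup>2"
    unfolding Y_def m_def by (rule variance_eq[OF W W2])
  then have Y2_le: "expectation (\<lambda>z. (Y z)\<^sup>2) \<le> expectation (\<lambda>z. (W z)\<^sup>2)" by simp
  let ?P = "Pi\<^sub>M {..<k} (\<lambda>_. M)"
  have err: "err \<omega> = (\<Sum>i<k. \<Sum>j<k. Y (\<omega> i) * Y (\<omega> j)) / (real k)\<^sup>2" for \<omega>
  proof -
    have "(1 / real k) * (\<Sum>i<k. W (\<omega> i)) - m = (\<Sum>i<k. Y (\<omega> i)) / real k"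
      using k by (simp add: Y_def sum_subtractf field_simps)
    then show ?thesis
      unfolding err_def m_def[symmetric] by (simp add: power_divide power2_eq_square sum_product)
  qed
  have YY: "integrable ?P (\<lambda>\<omega>. Y (\<omega> i) * Y (\<omega> j)) \<and>
      (\<integral>\<omega>. Y (\<omega> i) * Y (\<omega> j) \<partial>?P) = (if i = j then expectation (\<lambda>z. (Y z)\<^sup>2) else 0)"
    if ij: "i < k" "j < k" for i j
  proof (cases "i = j")
    case True
    \<comment> \<open>Padding with the constant 1 turns the integrand into a product over all
      coordinates, to which the product formula for integrals applies.\<close>
    define f where "f l = (\<lambda>z. if l = i then (Y z)\<^sup>2 else 1)" for l
    have f: "integrable M (f l)" for l using Y2 by (cases "l = i") (auto simp: f_def)
    have eq: "Y (\<omega> i) * Y (\<omega> j) = (\<Prod>l<k. f l (\<omega> l))" for \<omega>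
      using ij True by (simp add: f_def prod.delta power2_eq_square)
    have "(\<integral>\<omega>. (\<Prod>l<k. f l (\<omega> l)) \<partial>?P) = (\<Prod>l<k. expectation (f l))"
      by (rule P.product_integral_prod) (auto intro: f)
    also have "\<dots> = (\<Prod>l<k. if l = i then expectation (\<lambda>z. (Y z)\<^sup>2) else 1)"
      by (intro prod.cong) (auto simp: f_def prob_space)
    finally show ?thesis
      unfolding eq using ij True P.product_integrable_prod[of "{..<k}" f] f by simp
  next
    case False
    define f where "f l = (\<lambda>z. if l \<in> {i, j} then Y z else 1)" for l
    have f: "integrable M (f l)" for l using Y by (cases "l \<in> {i, j}") (auto simp: f_def)
    have eq: "Y (\<omega> i) * Y (\<omega> j) = (\<Prod>l<k. f l (\<omega> l))" for \<omega>
    proof -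
      have "(\<Prod>l<k. f l (\<omega> l)) = (\<Prod>l\<in>{i, j}. f l (\<omega> l))"
        using ij by (intro prod.mono_neutral_right) (auto simp: f_def)
      then show ?thesis using False by (simp add: f_def)
    qed
    have "(\<integral>\<omega>. (\<Prod>l<k. f l (\<omega> l)) \<partial>?P) = (\<Prod>l<k. expectation (f l))"
      by (rule P.product_integral_prod) (auto intro: f)
    also have "\<dots> = 0" using ij Y0 by (intro prod_zero bexI[of _ i]) (auto simp: f_def)
    finally show ?thesis
      unfolding eq using ij False P.product_integrable_prod[of "{..<k}" f] f by simp
  qed
  show "integrable ?P err" unfolding err using YY by (intro integrable_divide_zero Bochner_Integration.integrable_sum) auto
  have int: "integrable ?P (\<lambda>\<omega>. \<Sum>j<k. Y (\<omega> i) * Y (\<omega> j))" if "i < k" for i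
    using YY that by (intro Bochner_Integration.integrable_sum) auto
  have "integral\<^sup>L ?P err = (\<integral>\<omega>. (\<Sum>i<k. \<Sum>j<k. Y (\<omega> i) * Y (\<omega> j)) \<partial>?P) / (real k)\<^sup>2"
    unfolding err by simp
  also have "(\<integral>\<omega>. (\<Sum>i<k. \<Sum>j<k. Y (\<omega> i) * Y (\<omega> j)) \<partial>?P)
      = (\<Sum>i<k. \<integral>\<omega>. (\<Sum>j<k. Y (\<omega> i) * Y (\<omega> j)) \<partial>?P)"
    using int by (intro Bochner_Integration.integral_sum) auto
  also have "\<dots> = (\<Sum>i<k. \<Sum>j<k. \<integral>\<omega>. Y (\<omega> i) * Y (\<omega> j) \<partial>?P)"
    using YY by (intro sum.cong Bochner_Integration.integral_sum) auto
  also have "(\<Sum>i<k. \<Sum>j<k. \<integral>\<omega>. Y (\<omega> i) * Y (\<omega> j) \<partial>?P) = real k * expectation (\<lambda>z. (Y z)\<^sup>2)"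
    using YY by simp
  also have "\<dots> / (real k)\<^sup>2 = expectation (\<lambda>z. (Y z)\<^sup>2) / k" using k by (simp add: power2_eq_square)
  also have "\<dots> \<le> expectation (\<lambda>z. (W z)\<^sup>2) / k" using Y2_le by (simp add: divide_right_mono)
  finally show "integral\<^sup>L ?P err \<le> expectation (\<lambda>z. (W z)\<^sup>2) / k" .
qed

text \<open>After division by \<open>m\<close>, the root of the ratio is compared with 1 by
  \<open>abs_powr_minus_one_le\<close>, so only the variance of the sample mean enters; no lower
  bound on the sample mean is involved.\<close>

lemma (in prob_space) sample_mean_root_error:
  fixes W :: "'a \<Rightarrow> real" and k :: nat and t L :: real
  assumes W: "integrable M W" and W2: "integrable M (\<lambda>z. (W z)\<^sup>2)" and nonneg: "\<And>z. z \<in> space M \<Longrightarrow> 0 \<le> W z"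
    and k: "1 \<le> k" and t: "1 \<le> t"
  defines "m \<equiv> expectation W"
  assumes m: "0 < m"
  shows "(\<integral>\<omega>. (((1 / real k) * (\<Sum>i<k. W (\<omega> i))) powr (1 / t) - L)\<^sup>2 \<partial>Pi\<^sub>M {..<k} (\<lambda>_. M))
    \<le> 2 * (m powr (1 / t) / m)\<^sup>2 * (expectation (\<lambda>z. (W z)\<^sup>2) / k) + 2 * (m powr (1 / t) - L)\<^sup>2"
proof -
  let ?P = "Pi\<^sub>M {..<k} (\<lambda>_. M)"
  interpret P: prob_space ?P by (intro prob_space_PiM) (rule prob_space_axioms)
  define A where "A \<omega> = (1 / real k) * (\<Sum>i<k. W (\<omega> i))" for \<omega>
  define c where "c = 2 * (m powr (1 / t) / m)\<^sup>2"
  define d where "d = 2 * (m powr (1 / t) - L)\<^sup>2"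
  note var = sample_mean_square[OF W W2 k, folded A_def m_def]
  have pt: "(A \<omega> powr (1 / t) - L)\<^sup>2 \<le> c * (A \<omega> - m)\<^sup>2 + d" if "\<omega> \<in> space ?P" for \<omega>
  proof -
    have "\<omega> i \<in> space M" if "i < k" for i
      using \<open>\<omega> \<in> space ?P\<close> that by (auto simp: space_PiM PiE_def Pi_def)
    then have A: "0 \<le> A \<omega>" unfolding A_def using nonneg by (intro mult_nonneg_nonneg sum_nonneg) auto
    have "A \<omega> powr (1 / t) = m powr (1 / t) * (A \<omega> / m) powr (1 / t)"
      using A m by (simp add: powr_divide)
    then have "A \<omega> powr (1 / t) - m powr (1 / t) = m powr (1 / t) * ((A \<omega> / m) powr (1 / t) - 1)"
      by (simp add: algebra_simps)
    then have "\<bar>A \<omega> powr (1 / t) - m powr (1 / t)\<bar> \<le> m powr (1 / t) * \<bar>A \<omega> / m - 1\<bar>"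
      using abs_powr_minus_one_le[of "A \<omega> / m" "1 / t"] A m t by (simp add: abs_mult)
    also have "A \<omega> / m - 1 = (A \<omega> - m) / m" using m by (simp add: field_simps)
    also have "m powr (1 / t) * \<bar>(A \<omega> - m) / m\<bar> = \<bar>m powr (1 / t) / m * (A \<omega> - m)\<bar>"
      using m by (simp add: abs_mult)
    finally have 1: "(A \<omega> powr (1 / t) - m powr (1 / t))\<^sup>2 \<le> (m powr (1 / t) / m * (A \<omega> - m))\<^sup>2"
      by (simp only: abs_le_square_iff)
    have "(A \<omega> powr (1 / t) - L)\<^sup>2 \<le> 2 * (A \<omega> powr (1 / t) - m powr (1 / t))\<^sup>2 + 2 * (m powr (1 / t) - L)\<^sup>2"
      using sum_squares_bound[of "A \<omega> powr (1 / t) - m powr (1 / t)" "m powr (1 / t) - L"]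
      by (simp add: power2_eq_square algebra_simps)
    with 1 have "(A \<omega> powr (1 / t) - L)\<^sup>2 \<le> 2 * (m powr (1 / t) / m * (A \<omega> - m))\<^sup>2 + d"
      unfolding d_def by linarith
    then show ?thesis by (simp only: c_def power_mult_distrib mult.assoc)
  qed
  have "(\<integral>\<omega>. (A \<omega> powr (1 / t) - L)\<^sup>2 \<partial>?P) \<le> (\<integral>\<omega>. c * (A \<omega> - m)\<^sup>2 + d \<partial>?P)"
    \<comment> \<open>The dominating function is integrable and nonnegative. This suffices even for
      a left side that is not integrable, whose integral is 0.\<close>
    by (rule integral_mono') (use var(1) pt in \<open>auto simp: c_def d_def\<close>)
  also have "\<dots> = c * (\<integral>\<omega>. (A \<omega> - m)\<^sup>2 \<partial>?P) + d" using var(1) by (simp add: P.prob_space)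
  also have "\<dots> \<le> c * (expectation (\<lambda>z. (W z)\<^sup>2) / k) + d"
    using var(2) by (intro add_right_mono mult_left_mono) (auto simp: c_def)
  finally show ?thesis by (simp add: A_def c_def d_def)
qed

text \<open>This is Cauchy-Schwarz between \<open>X n\<close> and the indicator of its support, in
  the additive form that AM-GM gives for a fixed parameter \<open>c\<close>.\<close>

lemma (in prob_space) L2_bounded_vanishing_support:
  fixes X :: "nat \<Rightarrow> 'a \<Rightarrow> real"
  assumes int: "\<And>n. integrable M (X n)" and int2: "\<And>n. integrable M (\<lambda>z. (X n z)\<^sup>2)"
    and bd: "\<And>n. expectation (\<lambda>z. (X n z)\<^sup>2) \<le> K"
    and supp: "(\<lambda>n. prob {z \<in> space M. X n z \<noteq> 0}) \<longlonglongrightarrow> 0"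
    and lim: "\<And>n. m \<le> expectation (X n)"
  shows "m \<le> 0"
proof (rule ccontr)
  assume "\<not> m \<le> 0"
  then have m: "0 < m" by simp
  have "0 \<le> K" by (rule order_trans[OF Bochner_Integration.integral_nonneg bd[of 0]]) simp
  \<comment> \<open>With this choice \<open>c * K \<le> m\<close>, against the limiting inequality
    \<open>2 * m \<le> c * K\<close>. The 1 in the denominator covers \<open>K = 0\<close>.\<close>
  define c where "c = m / (K + 1)"
  have c: "0 < c" using m \<open>0 \<le> K\<close> by (simp add: c_def)
  have "2 * m \<le> c * K + prob {z \<in> space M. X n z \<noteq> 0} / c" for n
  proof -
    let ?S = "{z \<in> space M. X n z \<noteq> 0}"
    have [measurable]: "X n \<in> borel_measurable M" using int by auto
    have S: "?S \<in> events" by measurable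
    have "2 * m \<le> expectation (\<lambda>z. 2 * X n z)" using lim[of n] int by simp
    \<comment> \<open>AM-GM on the support: \<open>2 X \<le> c X\<^sup>2 + 1 / c\<close>\<close>
    also have "\<dots> \<le> expectation (\<lambda>z. c * (X n z)\<^sup>2 + indicator ?S z / c)"
    proof (rule integral_mono)
      fix z assume "z \<in> space M"
      have "0 \<le> (c * X n z - 1)\<^sup>2 / c" using c by simp
      also have "\<dots> = c * (X n z)\<^sup>2 - 2 * X n z + 1 / c" using c by (simp add: power2_eq_square field_simps)
      finally show "2 * X n z \<le> c * (X n z)\<^sup>2 + indicator ?S z / c"
        using \<open>z \<in> space M\<close> by (auto simp: indicator_def)
    qed (use int int2 S in \<open>auto simp: emeasure_eq_measure\<close>)
    also have "\<dots> = c * expectation (\<lambda>z. (X n z)\<^sup>2) + prob ?S / c"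
      using int2 S by (simp add: emeasure_eq_measure)
    finally show ?thesis using bd[of n] c by (smt (verit) mult_left_mono)
  qed
  moreover have "(\<lambda>n. c * K + prob {z \<in> space M. X n z \<noteq> 0} / c) \<longlonglongrightarrow> c * K + 0 / c"
    using c by (intro tendsto_intros supp) auto
  ultimately have "2 * m \<le> c * K" by (intro LIMSEQ_le_const[of _ "c * K"]) auto
  also have "\<dots> \<le> m" using m \<open>0 \<le> K\<close> by (simp add: c_def field_simps)
  finally show False using m by simp
qed

section \<open>Flight durations\<close>

definition admissible :: "transport \<Rightarrow> marks \<Rightarrow> bool" where
  "admissible S z \<longleftrightarrow> (\<forall>n. 0 < fst (z n) \<and> snd (z n) \<in> velocities S) \<and>
     (\<forall>t. finite {n. scatter_time z n \<le> ennreal t})"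

lemma space_path_space: "space (path_space S) = {z. admissible S z}"
  by (auto simp: path_space_def admissible_def space_restrict_space space_PiM)

lemma scatter_time_0 [simp]: "scatter_time z 0 = 0"
  by (simp add: scatter_time_def)

lemma scatter_time_Suc: "scatter_time z (Suc n) = scatter_time z n + fst (z n)"
  by (simp add: scatter_time_def)

lemma scatter_time_mono: "m \<le> n \<Longrightarrow> scatter_time z m \<le> scatter_time z n"
  unfolding scatter_time_def by (intro sum_mono2) auto

lemma scatter_count_eqI:
  assumes "scatter_time z n \<le> ennreal t" "ennreal t < scatter_time z (Suc n)"
  shows "scatter_count z t = n"
proof -
  have "{m. scatter_time z (Suc m) \<le> ennreal t} = {..<n}"
  proof (intro set_eqI iffI)
    fix m assume "m \<in> {m. scatter_time z (Suc m) \<le> ennreal t}"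
    then have "\<not> scatter_time z (Suc n) \<le> scatter_time z (Suc m)" using assms by auto
    then have "\<not> Suc n \<le> Suc m" using scatter_time_mono by blast
    then show "m \<in> {..<n}" by simp
  next
    fix m assume "m \<in> {..<n}"
    then have "scatter_time z (Suc m) \<le> scatter_time z n" by (intro scatter_time_mono) simp
    then show "m \<in> {m. scatter_time z (Suc m) \<le> ennreal t}" using assms by auto
  qed
  then show ?thesis by (simp add: scatter_count_def)
qed

lemma position_in_flight:
  assumes "scatter_time z n \<le> ennreal t" "ennreal t < scatter_time z (Suc n)"
  shows "position x z t =
    flight_start x z n + (t - enn2real (scatter_time z n)) *\<^sub>R flight_velocity x z n"
  by (simp add: position_def scatter_count_eqI[OF assms])

text \<open>As durations are strictly positive, the instant of a scatter belongs to the flight that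
  it starts.\<close>

lemma position_scatter_time:
  assumes "admissible S z" "scatter_time z n < \<infinity>"
  shows "position x z (enn2real (scatter_time z n)) = flight_start x z n"
proof -
  have e: "ennreal (enn2real (scatter_time z n)) = scatter_time z n"
    using assms(2) by (simp add: ennreal_enn2real)
  have "0 < fst (z n)" using assms(1) by (simp add: admissible_def)
  then have "scatter_time z n < scatter_time z (Suc n)"
    using assms(2) ennreal_add_left_cancel_less[of "scatter_time z n" 0 "fst (z n)"]
    by (simp add: scatter_time_Suc less_top)
  then show ?thesis by (subst position_in_flight[of _ n]) (auto simp: e)
qed

lemma flight_velocity_in_velocities:
  assumes "admissible S z" "x \<in> phase_space S"
  shows "flight_velocity x z n \<in> velocities S"
  using assms by (cases n) (auto simp: flight_velocity_def phase_space_def admissible_def)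

lemma position_in_region:
  assumes "ennreal t < exit_time S x z" "0 < s" "s \<le> t"
  shows "position x z s \<in> region S"
proof (rule ccontr)
  assume "position x z s \<notin> region S"
  then have "exit_time S x z \<le> ennreal s" unfolding exit_time_def using assms by (intro Inf_lower) auto
  also have "\<dots> \<le> ennreal t" using assms by (simp add: ennreal_leI)
  finally show False using assms by simp
qed

lemma phase_point_in_phase_space:
  assumes z: "admissible S z" and x: "x \<in> phase_space S"
    and t: "ennreal t < exit_time S x z" "0 \<le> s" "s \<le> t"
  shows "(position x z s, velocity x z s) \<in> phase_space S"
proof -
  have "position x z s \<in> region S"
  proof (cases "s = 0")
    \<comment> \<open>\<open>exit_time\<close> tests positive times only, so time 0 is settled by
      the starting point itself.\<close>
    case True
    have "position x z (enn2real (scatter_time z 0)) = flight_start x z 0"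
      by (rule position_scatter_time[OF z]) simp
    with True x show ?thesis by (auto simp: phase_space_def)
  next
    case False
    then show ?thesis using position_in_region t by auto
  qed
  then show ?thesis
    using flight_velocity_in_velocities[OF z x] by (simp add: phase_space_def velocity_def)
qed

lemma flight_start_in_region:
  assumes z: "admissible S z" and x: "x \<in> phase_space S"
    and "scatter_time z n < exit_time S x z"
  shows "flight_start x z n \<in> region S"
proof -
  have fin: "scatter_time z n < \<infinity>" using assms(3) by (metis infinity_ennreal_def less_top order_less_le_trans top_greatest)
  then have "ennreal (enn2real (scatter_time z n)) = scatter_time z n" by (simp add: ennreal_enn2real)
  with phase_point_in_phase_space[OF z x, of "enn2real (scatter_time z n)" "enn2real (scatter_time z n)"] assms(3)
  show ?thesis by (simp add: position_scatter_time[OF z fin] phase_space_def)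
qed

definition max_flight :: "transport \<Rightarrow> real" where
  "max_flight S = diameter (region S) / vmin S"

text \<open>Both ends of such a flight lie in the region, so its length, which is duration times
  speed, is at most the diameter; the speed is at least \<open>vmin S\<close>.\<close>

lemma flight_duration_le:
  assumes S: "bounded (region S)" "0 < vmin S"
    and z: "admissible S z" and x: "x \<in> phase_space S"
    and st: "scatter_time z (Suc n) < exit_time S x z" and i: "i \<le> n"
  shows "fst (z i) \<le> ennreal (max_flight S)"
proof -
  let ?w = "flight_velocity x z i" and ?u = "enn2real (fst (z i))"
  have lt: "scatter_time z j < exit_time S x z" if "j \<le> Suc n" for j
    using scatter_time_mono[OF that, of z] st by (rule order_le_less_trans)
  have "fst (z i) \<le> scatter_time z (Suc i)" by (simp add: scatter_time_Suc)
  also have "\<dots> < \<infinity>" using lt[of "Suc i"] i by (metis Suc_le_mono infinity_ennreal_def less_top order_less_le_trans top_greatest)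
  finally have fin: "fst (z i) < \<infinity>" .
  have "dist (flight_start x z (Suc i)) (flight_start x z i) \<le> diameter (region S)"
    using i by (intro diameter_bounded_bound[OF S(1)] flight_start_in_region[OF z x] lt) auto
  then have "?u * norm ?w \<le> diameter (region S)" by (simp add: dist_norm)
  moreover have "vmin S \<le> norm ?w"
    using flight_velocity_in_velocities[OF z x] by (simp add: velocities_def)
  then have "?u * vmin S \<le> ?u * norm ?w" by (intro mult_left_mono) auto
  ultimately have "?u \<le> max_flight S" using S(2) by (simp add: max_flight_def field_simps)
  then have "ennreal ?u \<le> ennreal (max_flight S)" by (rule ennreal_leI)
  then show ?thesis using fin by (simp add: ennreal_enn2real)
qed

text \<open>A walk that never exits cannot have an infinite flight, because moving straight at speed
  at least \<open>vmin S\<close> leaves a bounded region. Hence every flight ends at a scatter, and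
  the previous bound applies.\<close>

lemma eternal_flight_duration_le:
  assumes S: "bounded (region S)" "0 < vmin S"
    and z: "admissible S z" and x: "x \<in> phase_space S"
    and ex: "exit_time S x z = \<infinity>"
  shows "fst (z i) \<le> ennreal (max_flight S)"
proof (cases "scatter_time z (Suc i) < \<infinity>")
  case True
  then show ?thesis using flight_duration_le[OF S z x, of i i] ex by simp
next
  case False
  \<comment> \<open>The first flight that never ends starts at a finite time, whereas flight
    \<open>i\<close> may come after it and have no meaning.\<close>
  define n where "n = (LEAST n. scatter_time z (Suc n) = \<infinity>)"
  from False have "scatter_time z (Suc i) = \<infinity>" by (metis infinity_ennreal_def less_top)
  then have n: "scatter_time z (Suc n) = \<infinity>" unfolding n_def by (rule LeastI)
  have fin: "scatter_time z n < \<infinity>"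
  proof (cases n)
    case (Suc m)
    then have "scatter_time z (Suc m) \<noteq> \<infinity>" using not_less_Least[of m "\<lambda>n. scatter_time z (Suc n) = \<infinity>"] by (simp add: n_def)
    then show ?thesis using Suc by (simp add: top.not_eq_extremum)
  qed simp
  let ?w = "flight_velocity x z n" and ?T = "enn2real (scatter_time z n)"
  \<comment> \<open>After this time the walk has travelled further than the diameter, whatever its
    speed in the velocity set.\<close>
  define u where "u = (diameter (region S) + 1) / vmin S"
  have u: "0 < u" using S diameter_ge_0[OF S(1)] by (simp add: u_def)
  have T: "ennreal ?T = scatter_time z n" using fin by (simp add: ennreal_enn2real)
  have "scatter_time z n \<le> ennreal (?T + u)" using u T by (metis ennreal_leI le_add_same_cancel1 less_imp_le)
  then have "position x z (?T + u) = flight_start x z n + u *\<^sub>R ?w"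
    by (subst position_in_flight[of _ n]) (auto simp: n)
  moreover have "position x z (?T + u) \<in> region S"
    using u ex by (intro position_in_region[of "?T + u"]) (auto intro: add_nonneg_pos)
  moreover have "flight_start x z n \<in> region S"
    using flight_start_in_region[OF z x] ex fin by simp
  ultimately have "dist (flight_start x z n + u *\<^sub>R ?w) (flight_start x z n) \<le> diameter (region S)"
    using diameter_bounded_bound[OF S(1)] by metis
  then have "u * norm ?w \<le> diameter (region S)" using u by (simp add: dist_norm)
  moreover have "vmin S \<le> norm ?w"
    using flight_velocity_in_velocities[OF z x] by (simp add: velocities_def)
  then have "u * vmin S \<le> u * norm ?w" using u by (intro mult_left_mono) auto
  ultimately have False using S(2) by (simp add: u_def)
  then show ?thesis ..
qed

text \<open>The defect of the fundamental theorem of calculus for the merely Lipschitz \<open>H\<close> is quadratic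
  on short intervals, hence vanishes under refinement.\<close>

lemma le_if_quadratic_increments:
  fixes f :: "real \<Rightarrow> real"
  assumes "0 \<le> s" and inc: "\<And>u v. 0 \<le> u \<Longrightarrow> u \<le> v \<Longrightarrow> f v - f u \<le> K * (v - u)\<^sup>2"
  shows "f s \<le> f 0"
proof -
  have le: "f s - f 0 \<le> K * s\<^sup>2 / real (Suc N)" for N
  proof -
    let ?p = "\<lambda>i. s * real i / real (Suc N)"
    have "f s - f 0 = (\<Sum>i<Suc N. f (?p (Suc i)) - f (?p i))"
      by (subst sum_lessThan_telescope) simp
    also have "\<dots> \<le> (\<Sum>i<Suc N. K * (?p (Suc i) - ?p i)\<^sup>2)"
      using assms(1) by (intro sum_mono inc divide_right_mono mult_left_mono) auto
    also have "\<dots> = (\<Sum>i<Suc N. K * (s / real (Suc N))\<^sup>2)"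
      by (intro sum.cong refl) (simp add: diff_divide_distrib[symmetric] algebra_simps)
    also have "\<dots> = K * s\<^sup>2 / real (Suc N)" by (simp add: power2_eq_square)
    finally show ?thesis .
  qed
  have "(\<lambda>N. K * s\<^sup>2 / real (Suc N)) \<longlonglongrightarrow> 0"
    by real_asymp
  with le have "f s - f 0 \<le> 0" by (intro LIMSEQ_le_const[of _ 0 "f s - f 0"]) auto
  then show ?thesis by simp
qed

text \<open>The integrand is the density of the first ring of a clock with rate \<open>h\<close>, so
  its mass is \<open>1 - exp (- H s)\<close> and is largest for the constant rate \<open>a\<close>.
  Only the upper bound is proved: the sum \<open>exp (- H u) + G u\<close> does not
  increase.\<close>

lemma exponential_clock_mass:
  fixes h :: "real \<Rightarrow> real"
  assumes [measurable]: "h \<in> borel_measurable borel" and h: "\<And>u. 0 \<le> h u" "\<And>u. h u \<le> a" and s: "0 \<le> s"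
  defines "H \<equiv> \<lambda>u. LINT q:{0..u}|lborel. h q"
  shows "(\<integral>\<^sup>+u\<in>{0..s}. ennreal (exp (- H u) * h u) \<partial>lborel) \<le> ennreal (1 - exp (- a * s))"
proof -
  have "0 \<le> a" using h[of 0] by simp
  have int: "set_integrable lborel A g"
    if "A \<in> sets borel" "A \<subseteq> {0..u}" "g \<in> borel_measurable borel" "\<And>q. \<bar>g q\<bar> \<le> a" for A and u :: real and g
  proof (rule set_integrable_bound[of lborel A "\<lambda>_. a"])
    have "emeasure lborel A \<le> emeasure lborel {0..u}" using that(2) by (rule emeasure_mono) simp
    also have "\<dots> < \<infinity>" by (intro emeasure_compact_finite) simp
    finally show "set_integrable lborel A (\<lambda>_. a)"
      using that by (simp add: set_integrable_def)
  qed (use that h \<open>0 \<le> a\<close> in \<open>auto simp: set_borel_measurable_def\<close>)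
  have split: "(LINT q:{0..v}|lborel. g q) = (LINT q:{0..u}|lborel. g q) + (LINT q:{u<..v}|lborel. g q)"
    if "0 \<le> u" "u \<le> v" "g \<in> borel_measurable borel" "\<And>q. \<bar>g q\<bar> \<le> a" for u v :: real and g
  proof -
    have "{0..v} = {0..u} \<union> {u<..v}" using that by auto
    then show ?thesis using that
      by (simp only:, intro set_integral_Un int[of _ v]) auto
  qed
  define G where "G u = (LINT q:{0..u}|lborel. exp (- H q) * h q)" for u
  have Hinc: "0 \<le> (LINT q:{u<..v}|lborel. h q)" "(LINT q:{u<..v}|lborel. h q) \<le> a * (v - u)"
    if "0 \<le> u" "u \<le> v" for u v
  proof -
    show "0 \<le> (LINT q:{u<..v}|lborel. h q)"
      unfolding set_lebesgue_integral_def by (intro Bochner_Integration.integral_nonneg) (auto simp: h)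
    have "(LINT q:{u<..v}|lborel. h q) \<le> (LINT q:{u<..v}|lborel. a)"
      using that h \<open>0 \<le> a\<close> by (intro set_integral_mono int[of _ v]) auto
    also have "\<dots> = a * (v - u)" using that by (simp add: set_lebesgue_integral_def)
    finally show "(LINT q:{u<..v}|lborel. h q) \<le> a * (v - u)" .
  qed
  have hsplit: "H v = H u + (LINT q:{u<..v}|lborel. h q)" if "0 \<le> u" "u \<le> v" for u v
    unfolding H_def using that h by (intro split) (auto simp: abs_le_iff intro: order_trans[of _ 0])
  have null: "(LINT q:{0..u}|lborel. g q) = 0" if "u \<le> 0" for u :: real and g :: "real \<Rightarrow> real"
    unfolding set_lebesgue_integral_def
  proof (rule integral_eq_zero_AE)
    show "AE q in lborel. indicat_real {0..u} q *\<^sub>R g q = 0"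
      using AE_lborel_singleton[of 0] by eventually_elim (use that in \<open>auto simp: indicator_def\<close>)
  qed
  have H0: "H u = 0" if "u \<le> 0" for u unfolding H_def using that by (rule null)
  \<comment> \<open>Monotonicity on the whole line, negative arguments included, gives Borel
    measurability of \<open>H\<close>.\<close>
  have Hmono: "H u \<le> H v" if "u \<le> v" for u v
    using that hsplit[of u v] Hinc(1)[of u v] hsplit[of 0 v] Hinc(1)[of 0 v] H0[of u] H0[of v] H0[of 0]
    by (cases "0 \<le> u"; cases "0 \<le> v") auto
  then have [measurable]: "H \<in> borel_measurable borel" by (intro borel_measurable_mono monoI)
  have Hnn: "0 \<le> H u" for u using Hmono[of 0 u] H0[of u] H0[of 0] by (cases "0 \<le> u") auto
  have gbd: "\<bar>exp (- H q) * h q\<bar> \<le> a" for q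
    using mult_mono[of "exp (- H q)" 1 "h q" a] h Hnn \<open>0 \<le> a\<close> by (simp add: abs_mult)
  have "exp (- H s) + G s \<le> exp (- H 0) + G 0"
  proof (rule le_if_quadratic_increments[where K = "a\<^sup>2", OF s])
    fix u v :: real assume uv: "0 \<le> u" "u \<le> v"
    define \<Delta> where "\<Delta> = (LINT q:{u<..v}|lborel. h q)"
    have \<Delta>: "0 \<le> \<Delta>" "\<Delta> \<le> a * (v - u)" using Hinc[OF uv] by (auto simp: \<Delta>_def)
    have "G v - G u = (LINT q:{u<..v}|lborel. exp (- H q) * h q)"
      unfolding G_def using split[OF uv, of "\<lambda>q. exp (- H q) * h q"] gbd by simp
    \<comment> \<open>Freezing \<open>H\<close> at the left end only increases the integrand and
      leaves the error \<open>exp (- \<Delta>) - 1 + \<Delta>\<close>, quadratic in the increment of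
      \<open>H\<close>.\<close>
    also have "\<dots> \<le> (LINT q:{u<..v}|lborel. exp (- H u) * h q)"
    proof (intro set_integral_mono)
      show "set_integrable lborel {u<..v} (\<lambda>q. exp (- H q) * h q)"
        using gbd uv by (intro int[of _ v]) auto
      show "set_integrable lborel {u<..v} (\<lambda>q. exp (- H u) * h q)"
        using uv h by (intro set_integrable_mult_right int[of _ v]) (auto simp: abs_le_iff intro: order_trans[of _ 0])
    qed (auto intro!: mult_right_mono simp: h Hmono)
    also have "\<dots> = exp (- H u) * \<Delta>" by (simp add: \<Delta>_def)
    finally have "(exp (- H v) + G v) - (exp (- H u) + G u) \<le> exp (- H u) * (exp (- \<Delta>) - 1 + \<Delta>)"
      using hsplit[OF uv] by (simp add: \<Delta>_def algebra_simps exp_add[symmetric])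
    also have "\<dots> \<le> 1 * \<Delta>\<^sup>2"
    proof (intro mult_mono)
      \<comment> \<open>This route works for every nonnegative \<open>\<Delta>\<close>, as the
        interval is not assumed short.\<close>
      have "exp (- \<Delta>) \<le> 1 / (1 + \<Delta>)"
        using exp_ge_add_one_self[of \<Delta>] \<Delta> by (simp add: exp_minus field_simps)
      also have "\<dots> \<le> 1 - \<Delta> + \<Delta>\<^sup>2"
      proof -
        have "(1 - \<Delta> + \<Delta>\<^sup>2) * (1 + \<Delta>) = 1 + \<Delta> ^ 3" by (simp add: algebra_simps power2_eq_square power3_eq_cube)
        then have "1 \<le> (1 - \<Delta> + \<Delta>\<^sup>2) * (1 + \<Delta>)" using \<Delta> by simp
        then show ?thesis using \<Delta> by (simp add: divide_le_eq)
      qed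
      finally show "exp (- \<Delta>) - 1 + \<Delta> \<le> \<Delta>\<^sup>2" by simp
      show "0 \<le> exp (- \<Delta>) - 1 + \<Delta>" using exp_ge_add_one_self[of "- \<Delta>"] by linarith
    qed (use Hnn in auto)
    also have "\<dots> \<le> (a * (v - u))\<^sup>2" using \<Delta> by (simp add: power_mono)
    finally show "(exp (- H v) + G v) - (exp (- H u) + G u) \<le> a\<^sup>2 * (v - u)\<^sup>2"
      by (simp add: power_mult_distrib)
  qed
  moreover have "G 0 = 0" unfolding G_def by (rule null) simp
  moreover have "H s \<le> a * s" using hsplit[of 0 s] Hinc(2)[of 0 s] H0[of 0] s by simp
  ultimately have "G s \<le> 1 - exp (- a * s)" using H0[of 0] by (smt (verit) exp_le_cancel_iff exp_zero minus_mult_left)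
  moreover have "(\<integral>\<^sup>+u\<in>{0..s}. ennreal (exp (- H u) * h u) \<partial>lborel) = ennreal (G s)"
  proof -
    have "(\<integral>\<^sup>+u\<in>{0..s}. ennreal (exp (- H u) * h u) \<partial>lborel)
        = (\<integral>\<^sup>+u. ennreal (indicator {0..s} u *\<^sub>R (exp (- H u) * h u)) \<partial>lborel)"
      by (intro nn_integral_cong) (auto simp: indicator_def)
    also have "\<dots> = ennreal (G s)"
      unfolding G_def set_lebesgue_integral_def
      using int[of "{0..s}" s "\<lambda>q. exp (- H q) * h q"] gbd
      by (intro nn_integral_eq_integral) (auto simp: set_integrable_def h)
    finally show ?thesis .
  qed
  ultimately show ?thesis by (simp add: ennreal_leI)
qed

section \<open>Scattering before exit\<close>

locale neutron_transport =
  fixes S :: transport and n_max :: real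
  assumes transport: "transport_assms S n_max"
begin

lemma region: "open (region S)" "bounded (region S)"
  and vmin: "0 < vmin S"
  using transport by (auto simp: transport_assms_def Let_def)

lemma velocities_compact: "compact (velocities S)"
proof -
  have "velocities S = cball 0 (vmax S) - ball 0 (vmin S)"
    by (auto simp: velocities_def dist_norm)
  then show ?thesis by (simp add: compact_diff)
qed

lemma borel_sets [measurable]: "region S \<in> sets borel" "velocities S \<in> sets borel"
  using region(1) velocities_compact by (auto intro: compact_imp_closed borel_closed)

text \<open>The cross-sections are measurable only on the restricted spaces. Multiplied by
  indicators they become Borel on the whole space, and the kernel is a combination of these products
  because it vanishes off the domain.\<close>

lemma scatter_kernel_measurable:
  "(\<lambda>(r, v, v'). scatter_kernel S r v v') \<in> borel_measurable borel"
proof -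
  let ?D = "region S" and ?V = "velocities S"
  have DV: "?D \<times> ?V \<in> sets borel" and DVV: "?D \<times> ?V \<times> ?V \<in> sets borel"
    unfolding borel_prod[symmetric] by (intro pair_measureI borel_sets)+
  have 2: "(\<lambda>(r, v). f r v * indicat_real (?D \<times> ?V) (r, v)) \<in> borel_measurable borel"
    if "(\<lambda>(r, v). f r v) \<in> borel_measurable (restrict_space borel (?D \<times> ?V))" for f
    using that DV by (subst (asm) borel_measurable_restrict_space_iff) (auto simp: case_prod_beta' mult.commute)
  have 3: "(\<lambda>(r, v, v'). f r v v' * indicat_real (?D \<times> ?V \<times> ?V) (r, v, v')) \<in> borel_measurable borel"
    if "(\<lambda>(r, v, v'). f r v v') \<in> borel_measurable (restrict_space borel (?D \<times> ?V \<times> ?V))" for f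
    using that DVV by (subst (asm) borel_measurable_restrict_space_iff) (auto simp: case_prod_beta' mult.commute)
  have proj: "(\<lambda>(r, v, v'). (r, v)) \<in> borel_measurable (borel :: (vec3 \<times> vec3 \<times> vec3) measure)"
    by (intro borel_measurable_continuous_onI) (auto simp: case_prod_beta' intro!: continuous_intros)
  have m: "(\<lambda>(r, v). \<sigma>\<^sub>s S r v) \<in> borel_measurable (restrict_space borel (?D \<times> ?V))"
    "(\<lambda>(r, v). \<sigma>\<^sub>f S r v) \<in> borel_measurable (restrict_space borel (?D \<times> ?V))"
    "(\<lambda>(r, v, v'). \<pi>\<^sub>s S r v v') \<in> borel_measurable (restrict_space borel (?D \<times> ?V \<times> ?V))"
    "(\<lambda>(r, v, v'). \<pi>\<^sub>f S r v v') \<in> borel_measurable (restrict_space borel (?D \<times> ?V \<times> ?V))"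
    using transport by (auto simp: transport_assms_def Let_def)
  have eq: "(\<lambda>(r, v, v'). scatter_kernel S r v v') = (\<lambda>p.
      (case (case p of (r, v, v') \<Rightarrow> (r, v)) of (r, v) \<Rightarrow> \<sigma>\<^sub>s S r v * indicat_real (?D \<times> ?V) (r, v)) *
      (case p of (r, v, v') \<Rightarrow> \<pi>\<^sub>s S r v v' * indicat_real (?D \<times> ?V \<times> ?V) (r, v, v')) +
      (case (case p of (r, v, v') \<Rightarrow> (r, v)) of (r, v) \<Rightarrow> \<sigma>\<^sub>f S r v * indicat_real (?D \<times> ?V) (r, v)) *
      (case p of (r, v, v') \<Rightarrow> \<pi>\<^sub>f S r v v' * indicat_real (?D \<times> ?V \<times> ?V) (r, v, v')))"
    by (auto simp: scatter_kernel_def indicator_def fun_eq_iff)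
  show ?thesis unfolding eq
    by (intro borel_measurable_add borel_measurable_times 3 m
        measurable_compose[OF proj 2[OF m(1)]] measurable_compose[OF proj 2[OF m(2)]])
qed

lemma ex_scatter_kernel_bound:
  obtains K where "0 \<le> K" "\<And>r v v'. scatter_kernel S r v v' \<le> K * indicator (velocities S) v'"
proof -
  let ?D = "region S" and ?V = "velocities S"
  have b: "bounded ((\<lambda>(r, v). \<sigma>\<^sub>s S r v) ` (?D \<times> ?V))"
     "bounded ((\<lambda>(r, v). \<sigma>\<^sub>f S r v) ` (?D \<times> ?V))"
     "bounded ((\<lambda>(r, v, v'). \<pi>\<^sub>s S r v v') ` (?D \<times> ?V \<times> ?V))"
     "bounded ((\<lambda>(r, v, v'). \<pi>\<^sub>f S r v v') ` (?D \<times> ?V \<times> ?V))"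
    using transport by (auto simp: transport_assms_def Let_def)
  obtain K1 where K1: "\<And>r v. r \<in> ?D \<Longrightarrow> v \<in> ?V \<Longrightarrow> \<bar>\<sigma>\<^sub>s S r v\<bar> \<le> K1"
    using b(1) by (fastforce simp: bounded_iff)
  obtain K2 where K2: "\<And>r v. r \<in> ?D \<Longrightarrow> v \<in> ?V \<Longrightarrow> \<bar>\<sigma>\<^sub>f S r v\<bar> \<le> K2"
    using b(2) by (fastforce simp: bounded_iff)
  obtain K3 where K3: "\<And>r v v'. r \<in> ?D \<Longrightarrow> v \<in> ?V \<Longrightarrow> v' \<in> ?V \<Longrightarrow> \<bar>\<pi>\<^sub>s S r v v'\<bar> \<le> K3"
    using b(3) by (fastforce simp: bounded_iff)
  obtain K4 where K4: "\<And>r v v'. r \<in> ?D \<Longrightarrow> v \<in> ?V \<Longrightarrow> v' \<in> ?V \<Longrightarrow> \<bar>\<pi>\<^sub>f S r v v'\<bar> \<le> K4"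
    using b(4) by (fastforce simp: bounded_iff)
  have "scatter_kernel S r v v' \<le> (\<bar>K1\<bar> * \<bar>K3\<bar> + \<bar>K2\<bar> * \<bar>K4\<bar>) * indicator ?V v'" for r v v'
  proof (cases "r \<in> ?D \<and> v \<in> ?V \<and> v' \<in> ?V")
    case True
    have "\<sigma>\<^sub>s S r v * \<pi>\<^sub>s S r v v' \<le> \<bar>\<sigma>\<^sub>s S r v\<bar> * \<bar>\<pi>\<^sub>s S r v v'\<bar>" by (metis abs_ge_self abs_mult)
    also have "\<dots> \<le> \<bar>K1\<bar> * \<bar>K3\<bar>" using K1[of r v] K3[of r v v'] True by (intro mult_mono) auto
    finally have 1: "\<sigma>\<^sub>s S r v * \<pi>\<^sub>s S r v v' \<le> \<bar>K1\<bar> * \<bar>K3\<bar>" .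
    have "\<sigma>\<^sub>f S r v * \<pi>\<^sub>f S r v v' \<le> \<bar>\<sigma>\<^sub>f S r v\<bar> * \<bar>\<pi>\<^sub>f S r v v'\<bar>" by (metis abs_ge_self abs_mult)
    also have "\<dots> \<le> \<bar>K2\<bar> * \<bar>K4\<bar>" using K2[of r v] K4[of r v v'] True by (intro mult_mono) auto
    finally show ?thesis using 1 True by (simp add: scatter_kernel_def)
  qed (auto simp: scatter_kernel_def)
  then show thesis by (intro that[of "\<bar>K1\<bar> * \<bar>K3\<bar> + \<bar>K2\<bar> * \<bar>K4\<bar>"]) auto
qed

lemma scatter_kernel_nonneg: "0 \<le> scatter_kernel S r v v'"
  using transport by (auto simp: transport_assms_def Let_def scatter_kernel_def)

lemma scatter_kernel_integrable: "integrable lborel (scatter_kernel S r v)"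
proof -
  obtain K where K: "0 \<le> K" "\<And>r v v'. scatter_kernel S r v v' \<le> K * indicator (velocities S) v'"
    using ex_scatter_kernel_bound by blast
  have "(\<lambda>v'. (r, v, v')) \<in> borel_measurable borel"
    by (intro borel_measurable_continuous_onI continuous_intros)
  from measurable_compose[OF this scatter_kernel_measurable]
  have m: "scatter_kernel S r v \<in> borel_measurable lborel" by simp
  have "emeasure lborel (velocities S) < \<infinity>" using velocities_compact by (intro emeasure_compact_finite)
  then have "integrable lborel (\<lambda>v'. K * indicator (velocities S) v')" by simp
  then show ?thesis
    by (rule Bochner_Integration.integrable_bound) (use m K scatter_kernel_nonneg in auto)
qed

lemma scatter_rate_nonneg: "0 \<le> scatter_rate S r v"
  unfolding scatter_rate_def by (intro Bochner_Integration.integral_nonneg) (simp add: scatter_kernel_nonneg)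

lemma ex_scatter_rate_bound:
  obtains a where "0 \<le> a" "\<And>r v. scatter_rate S r v \<le> a"
proof -
  obtain K where K: "0 \<le> K" "\<And>r v v'. scatter_kernel S r v v' \<le> K * indicator (velocities S) v'"
    using ex_scatter_kernel_bound by blast
  have "emeasure lborel (velocities S) < \<infinity>" using velocities_compact by (intro emeasure_compact_finite)
  then have "scatter_rate S r v \<le> (LINT v'|lborel. K * indicator (velocities S) v')" for r v
    unfolding scatter_rate_def by (intro integral_mono scatter_kernel_integrable K(2)) simp
  moreover have "0 \<le> (LINT v'|lborel. K * indicator (velocities S) v')" using K by (intro Bochner_Integration.integral_nonneg) simp
  ultimately show thesis using that by blast
qed

lemma scatter_rate_measurable: "(\<lambda>(r, v). scatter_rate S r v) \<in> borel_measurable borel"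
proof -
  have "(\<lambda>p. (fst (fst p), snd (fst p), snd p)) \<in> borel_measurable (borel :: ((vec3 \<times> vec3) \<times> vec3) measure)"
    by (intro borel_measurable_continuous_onI continuous_intros)
  from measurable_compose[OF this scatter_kernel_measurable]
  have "(\<lambda>(p, v'). scatter_kernel S (fst p) (snd p) v') \<in> borel_measurable (borel \<Otimes>\<^sub>M lborel)"
    unfolding borel_prod[symmetric] by (simp add: case_prod_beta' cong: measurable_cong_sets)
  from lborel.borel_measurable_lebesgue_integral[OF this]
  show ?thesis by (simp add: scatter_rate_def case_prod_beta')
qed

text \<open>The outgoing velocity carries mass at most 1, so what remains is the probability that a
  clock with rate at most \<open>a\<close> rings by time \<open>s\<close>, uniformly in the position
  and velocity.\<close>

lemma next_mark_prob_le:
  assumes a: "\<And>r v. scatter_rate S r v \<le> a" and "0 \<le> s"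
  shows "next_mark_prob S y w s B \<le> ennreal (1 - exp (- a * s))"
proof -
  let ?h = "\<lambda>u. scatter_rate S (y + u *\<^sub>R w) w"
  have "(\<lambda>u. (y + u *\<^sub>R w, w)) \<in> borel_measurable borel"
    by (intro borel_measurable_continuous_onI continuous_intros)
  from measurable_compose[OF this scatter_rate_measurable]
  have h: "?h \<in> borel_measurable borel" by simp
  have "next_mark_prob S y w s B
      \<le> (\<integral>\<^sup>+u\<in>{0..s}. ennreal (survival S y w u * ?h u) \<partial>lborel)"
    unfolding next_mark_prob_def
  proof (intro nn_integral_mono mult_right_mono)
    fix u
    let ?r = "y + u *\<^sub>R w"
    show "ennreal (survival S y w u * ?h u) * (\<integral>\<^sup>+v'\<in>B. ennreal (scatter_density S ?r w v') \<partial>lborel)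
        \<le> ennreal (survival S y w u * ?h u)"
    \<comment> \<open>The scatter density is normalised only where the rate is positive; where the
      rate is 0, the first factor vanishes.\<close>
    proof (cases "?h u = 0")
      case False
      then have pos: "0 < ?h u" using scatter_rate_nonneg by (simp add: order_less_le)
      have "(\<integral>\<^sup>+v'\<in>B. ennreal (scatter_density S ?r w v') \<partial>lborel)
          \<le> (\<integral>\<^sup>+v'. ennreal (scatter_density S ?r w v') \<partial>lborel)"
        by (intro nn_integral_mono) (auto simp: indicator_def)
      also have "\<dots> = ennreal (LINT v'|lborel. scatter_density S ?r w v')"
        unfolding scatter_density_def
        using scatter_kernel_integrable scatter_kernel_nonneg scatter_rate_nonneg
        by (intro nn_integral_eq_integral) auto
      also have "(LINT v'|lborel. scatter_density S ?r w v') = 1"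
        using pos by (simp add: scatter_density_def scatter_rate_def)
      finally show ?thesis using mult_left_mono[of _ 1] by fastforce
    qed simp
  qed simp
  also have "\<dots> \<le> ennreal (1 - exp (- a * s))"
    unfolding survival_def
    using h a assms(2) scatter_rate_nonneg by (intro exponential_clock_mass) auto
  finally show ?thesis .
qed

lemma ex_beta_bound:
  obtains B where "0 \<le> B" "\<And>x. x \<in> phase_space S \<Longrightarrow> \<bar>\<beta> S x\<bar> \<le> B"
proof -
  let ?D = "region S" and ?V = "velocities S"
  obtain K where K: "\<And>r v. r \<in> ?D \<Longrightarrow> v \<in> ?V \<Longrightarrow> \<bar>\<sigma>\<^sub>f S r v\<bar> \<le> K"
  proof -
    have "bounded ((\<lambda>(r, v). \<sigma>\<^sub>f S r v) ` (?D \<times> ?V))"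
      using transport by (auto simp: transport_assms_def Let_def)
    then show thesis using that by (fastforce simp: bounded_iff)
  qed
  have "\<bar>\<beta> S (r, v)\<bar> \<le> \<bar>K\<bar> * (n_max + 1)" if rv: "r \<in> ?D" "v \<in> ?V" for r v
  proof -
    have "0 \<le> (LINT v':?V|lborel. \<pi>\<^sub>f S r v v')"
      unfolding set_lebesgue_integral_def using transport rv
      by (intro Bochner_Integration.integral_nonneg) (auto simp: transport_assms_def Let_def indicator_def)
    moreover have "(LINT v':?V|lborel. \<pi>\<^sub>f S r v v') \<le> n_max"
      using transport rv by (auto simp: transport_assms_def Let_def)
    ultimately have "\<bar>(LINT v':?V|lborel. \<pi>\<^sub>f S r v v') - 1\<bar> \<le> n_max + 1" by linarith
    then show ?thesis unfolding \<beta>_def using K[OF rv] by (auto simp: abs_mult intro!: mult_mono)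
  qed
  moreover have "0 \<le> \<bar>K\<bar> * (n_max + 1)"
    using transport by (auto simp: transport_assms_def Let_def)
  ultimately show thesis using that by (auto simp: phase_space_def)
qed

end

section \<open>Geometric tails of the scatter count, and almost sure exit\<close>

locale neutron_walk = neutron_transport +
  fixes x :: phase and M :: "marks measure"
  assumes x: "x \<in> phase_space S" and law: "nrw_law S x M"
begin

sublocale prob_space M using law by (simp add: nrw_law_def)

lemma space_eq: "space M = {z. admissible S z}"
  using law sets_eq_imp_space_eq[of M "path_space S"] by (simp add: nrw_law_def space_path_space)

text \<open>These events contain both the survival past scatter \<open>n\<close> (for positive
  \<open>n\<close>) and the eternal walks. They are phrased through durations alone, so the law of
  the marks applies to them directly.\<close>

definition "short_flights n = {z \<in> space M. \<forall>i<n. fst (z i) \<le> ennreal (max_flight S)}"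

lemma short_flights_measurable [measurable]: "short_flights n \<in> sets M"
proof -
  have [measurable]: "(\<lambda>z. z i) \<in> measurable M borel" for i
  proof -
    have "(\<lambda>z. z i) \<in> measurable (Pi\<^sub>M UNIV (\<lambda>_. borel)) borel" by measurable
    then have "(\<lambda>z. z i) \<in> measurable (path_space S) borel"
      unfolding path_space_def by (rule measurable_restrict_space1)
    then show ?thesis using law by (simp add: nrw_law_def cong: measurable_cong_sets)
  qed
  have [measurable]: "fst \<in> borel_measurable (borel :: (ennreal \<times> vec3) measure)"
    by (intro borel_measurable_continuous_onI continuous_intros)
  show ?thesis unfolding short_flights_def by measurable
qed

lemma ex_short_flights_decay:
  obtains q where "0 \<le> q" "q < 1" "\<And>n. emeasure M (short_flights n) \<le> ennreal (q ^ n)"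
proof -
  obtain a where a: "0 \<le> a" "\<And>r v. scatter_rate S r v \<le> a" using ex_scatter_rate_bound by blast
  define L where "L = max_flight S"
  have L: "0 \<le> L" using diameter_ge_0[OF region(2)] vmin by (simp add: L_def max_flight_def)
  \<comment> \<open>This bounds, whatever the past, the probability that the next flight ends within
    \<open>L\<close>; induction on the number of flights multiplies these bounds.\<close>
  define q where "q = 1 - exp (- a * L)"
  have q: "0 \<le> q" "q < 1" using a L by (auto simp: q_def)
  have "emeasure M (short_flights n) \<le> ennreal (q ^ n)" for n
  proof (induction n)
    case 0
    then show ?case using emeasure_le_1 by simp
  next
    case (Suc n)
    define A where "A = (\<Pi>\<^sub>E i\<in>{..<n}. {p :: ennreal \<times> vec3. fst p \<le> ennreal L})"
    define E where "E = {z \<in> space M. restrict z {..<n} \<in> A \<and> scatter_time z n < \<infinity>}"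
    have "closed {p :: ennreal \<times> vec3. fst p \<le> ennreal L}"
      by (intro closed_Collect_le continuous_intros)
    then have A: "A \<in> sets (Pi\<^sub>M {..<n} (\<lambda>_. borel))"
      unfolding A_def by (intro sets_PiM_I_finite) auto
    \<comment> \<open>The finiteness clause required by \<open>nrw_law\<close> is automatic, since
      \<open>n\<close> bounded durations have a finite sum.\<close>
    have E: "E = short_flights n"
    proof -
      have "scatter_time z n < \<infinity>" if "\<forall>i<n. fst (z i) \<le> ennreal L" for z
        unfolding scatter_time_def using that
        by (auto simp: ennreal_sum_less_top intro: order_le_less_trans)
      then show ?thesis by (auto simp: E_def short_flights_def A_def L_def)
    qed
    have "short_flights (Suc n) = {z \<in> E. fst (z n) \<le> ennreal L \<and> snd (z n) \<in> UNIV}"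
      unfolding E by (auto simp: short_flights_def L_def less_Suc_eq)
    then have "emeasure M (short_flights (Suc n))
        = (\<integral>\<^sup>+z\<in>E. next_mark_prob S (flight_start x z n) (flight_velocity x z n) L UNIV \<partial>M)"

      using law[unfolded nrw_law_def Let_def, THEN conjunct2, THEN conjunct2, rule_format, OF A L, of UNIV]
      unfolding E_def by simp
    also have "\<dots> \<le> (\<integral>\<^sup>+z. ennreal q * indicator E z \<partial>M)"
      unfolding q_def using next_mark_prob_le[OF a(2) L] by (intro nn_integral_mono mult_right_mono) auto
    also have "\<dots> = ennreal q * emeasure M (short_flights n)" by (simp add: E nn_integral_cmult_indicator)
    also have "\<dots> \<le> ennreal q * ennreal (q ^ n)" using Suc by (rule mult_left_mono) simp
    also have "\<dots> = ennreal (q ^ Suc n)" using q by (simp add: ennreal_mult)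
    finally show ?case .
  qed
  with q show thesis by (rule that)
qed

text \<open>Scatter \<open>Suc j\<close> contributes at most 1, and only if the first
  \<open>Suc j\<close> flights were short. Summing the geometric bounds removes all dependence on
  \<open>t\<close>.\<close>

lemma ex_scatter_cost_bound:
  obtains Q where "0 \<le> Q" "\<And>k t. (\<integral>\<^sup>+z. cost S k t x z \<partial>M) \<le> ennreal (Q * real k)"
proof -
  obtain q where q: "0 \<le> q" "q < 1" "\<And>n. emeasure M (short_flights n) \<le> ennreal (q ^ n)"
    using ex_short_flights_decay by blast
  have pc: "path_cost S f t x z \<le> (\<Sum>j. indicator (short_flights (Suc j)) z)"
    if f: "f \<in> Linf_plus_ball S" and z: "z \<in> space M" for f t z
    unfolding path_cost_def Let_def
  proof (rule suminf_le)
    fix j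
    let ?T = "scatter_time z (Suc j)"
    show "(if ?T \<le> ennreal t \<and> ?T < exit_time S x z
        then ennreal (f (position x z (enn2real ?T), velocity x z (enn2real ?T))) else 0)
        \<le> indicator (short_flights (Suc j)) z"
    proof (cases "?T \<le> ennreal t \<and> ?T < exit_time S x z")
      case True
      have adm: "admissible S z" using z by (simp add: space_eq)
      from True have "?T < \<infinity>" by (auto intro: order_le_less_trans)
      then have T: "ennreal (enn2real ?T) = ?T" by (simp add: ennreal_enn2real)
      have "(position x z (enn2real ?T), velocity x z (enn2real ?T)) \<in> phase_space S"
        using True T by (intro phase_point_in_phase_space[OF adm x, of "enn2real ?T"]) auto
      then have "f (position x z (enn2real ?T), velocity x z (enn2real ?T)) \<le> 1"
        using f by (fastforce simp: Linf_plus_ball_def)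
      moreover have "z \<in> short_flights (Suc j)"
        using flight_duration_le[OF region(2) vmin adm x] True z by (auto simp: short_flights_def less_Suc_eq_le)
      ultimately show ?thesis using True by (simp add: ennreal_le_1)
    qed (simp only: if_False zero_le)
  qed (rule summableI)+
  define Q where "Q = q / (1 - q)"
  have "(\<integral>\<^sup>+z. cost S k t x z \<partial>M) \<le> ennreal (Q * real k)" for k t
  proof -
    \<comment> \<open>The supremum over \<open>f\<close> is bounded pointwise, before
      integration.\<close>
    have "(\<integral>\<^sup>+z. cost S k t x z \<partial>M) \<le> (\<integral>\<^sup>+z. of_nat k * (\<Sum>j. indicator (short_flights (Suc j)) z) \<partial>M)"
      unfolding cost_def using pc by (intro nn_integral_mono mult_left_mono SUP_least) auto
    also have "\<dots> = of_nat k * (\<Sum>j. emeasure M (short_flights (Suc j)))"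
      by (simp add: nn_integral_cmult nn_integral_suminf)
    also have "\<dots> \<le> of_nat k * (\<Sum>j. ennreal (q ^ Suc j))"
      by (intro mult_left_mono suminf_le summableI q(3)) simp
    also have "(\<Sum>j. ennreal (q ^ Suc j)) = ennreal Q"
    proof (rule suminf_ennreal_eq)
      have "(\<lambda>j. q * q ^ j) sums (q * (1 / (1 - q)))" using q by (intro sums_mult geometric_sums) auto
      then show "(\<lambda>j. q ^ Suc j) sums Q" by (simp add: Q_def)
    qed (use q in auto)
    also have "of_nat k * ennreal Q = ennreal (real k * Q)"
      by (simp only: ennreal_of_nat_eq_real_of_nat ennreal_mult' of_nat_0_le_iff)
    also have "real k * Q = Q * real k" by (rule mult.commute)
    finally show ?thesis .
  qed
  moreover have "0 \<le> Q" using q by (simp add: Q_def)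
  ultimately show thesis using that by blast
qed

text \<open>Eternal walks lie in \<open>short_flights n\<close> for every \<open>n\<close>, and
  these events have geometrically small probability.\<close>

lemma eternal_null:
  assumes "E \<in> sets M" "\<And>z. z \<in> E \<Longrightarrow> exit_time S x z = \<infinity>"
  shows "emeasure M E = 0"
proof -
  obtain q where q: "0 \<le> q" "q < 1" "\<And>n. emeasure M (short_flights n) \<le> ennreal (q ^ n)"
    using ex_short_flights_decay by blast
  have "E \<subseteq> short_flights n" for n
  proof
    fix z assume z: "z \<in> E"
    with assms(1) have "z \<in> space M" by (blast dest: sets.sets_into_space)
    then show "z \<in> short_flights n"
      using eternal_flight_duration_le[OF region(2) vmin _ x assms(2)[OF z]]
      by (auto simp: short_flights_def space_eq)
  qed
  then have "emeasure M E \<le> ennreal (q ^ n)" for n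
    using q(3) emeasure_mono[OF _ short_flights_measurable] order_trans by blast
  moreover have "(\<lambda>n. ennreal (q ^ n)) \<longlonglongrightarrow> ennreal 0"
    using q by (intro tendsto_ennrealI LIMSEQ_realpow_zero) auto
  ultimately have "emeasure M E \<le> ennreal 0" by (intro LIMSEQ_le_const) auto
  then show ?thesis by simp
qed

end

section \<open>Moments of the weights\<close>

text \<open>Squaring doubles the exponent, so the second moment is governed by the semigroup of
  \<open>2 * \<beta>\<close>; this is how \<open>lam\<^sub>1\<close> enters.\<close>

lemma weight_sq:
  "(weight S b g t x z)\<^sup>2 = weight S (\<lambda>y. 2 * b y) (\<lambda>y. (g y)\<^sup>2) t x z"
  unfolding weight_def power_mult_distrib set_integral_mult_right exp_double
  by (simp add: of_bool_def)

lemma weight_scale: "weight S b (\<lambda>y. c * g y) t x z = c * weight S b g t x z"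
  by (simp add: weight_def)

lemma semigroup_op_scale: "semigroup_op S P b t (\<lambda>y. c * g y) x = c * semigroup_op S P b t g x"
  by (simp add: semigroup_op_def weight_scale)

lemma pairing_scale: "pairing S f (\<lambda>y. c * g y) = c * pairing S f g"
proof -
  have "pairing S f (\<lambda>y. c * g y) = (LINT x:phase_space S|lborel. c * (f x * g x))"
    unfolding pairing_def by (simp only: mult.left_commute)
  then show ?thesis by (simp add: pairing_def)
qed

lemma pairing_commute: "pairing S f g = pairing S g f"
  by (simp add: pairing_def mult.commute)

lemma Linf_plus_bound:
  assumes "g \<in> Linf_plus S"
  obtains G where "0 < G" "\<And>y. y \<in> phase_space S \<Longrightarrow> g y \<le> G"
proof -
  have "bounded (g ` phase_space S)" using assms by (simp add: Linf_plus_def)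
  then obtain G where G: "\<forall>u\<in>g ` phase_space S. norm u \<le> G" unfolding bounded_iff by blast
  have "g y \<le> \<bar>G\<bar> + 1" if "y \<in> phase_space S" for y
    using bspec[OF G imageI[OF that]] by simp
  then show thesis using that[of "\<bar>G\<bar> + 1"] by simp
qed

lemma Linf_plus_square:
  assumes "g \<in> Linf_plus S"
  shows "(\<lambda>y. (g y)\<^sup>2) \<in> Linf_plus S"
proof -
  obtain G where "0 < G" "\<And>y. y \<in> phase_space S \<Longrightarrow> g y \<le> G" using Linf_plus_bound[OF assms] by blast
  then have "norm ((g y)\<^sup>2) \<le> G\<^sup>2" if "y \<in> phase_space S" for y
    using assms that by (simp add: Linf_plus_def power_mono)
  then have "bounded ((\<lambda>y. (g y)\<^sup>2) ` phase_space S)"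
    unfolding bounded_iff by (intro exI[of _ "G\<^sup>2"] ballI) (elim imageE, simp only:)
  then show ?thesis using assms by (auto simp: Linf_plus_def)
qed

lemma leading_eigentriple_tendsto:
  assumes "leading_eigentriple S P b lam \<phi> \<phi>'" and g: "g \<in> Linf_plus S" and x: "x \<in> phase_space S"
  shows "((\<lambda>t. exp (- lam * t) * semigroup_op S P b t g x) \<longlongrightarrow> pairing S \<phi>' g * \<phi> x) at_top"
proof -
  obtain G where G: "0 < G" "\<And>y. y \<in> phase_space S \<Longrightarrow> g y \<le> G" using Linf_plus_bound[OF g] by blast
  \<comment> \<open>The uniform convergence concerns functions bounded by 1, so \<open>g\<close> is
    rescaled and the factor restored by linearity.\<close>
  define h where "h y = 1 / G * g y" for y
  have gh: "g = (\<lambda>y. G * h y)" using G by (simp add: h_def)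
  have g': "g \<in> borel_measurable (restrict_space borel (phase_space S))"
    "\<And>y. y \<in> phase_space S \<Longrightarrow> 0 \<le> g y"
    using g by (auto simp: Linf_plus_def)
  have hb: "0 \<le> h y" "\<bar>h y\<bar> \<le> 1" if "y \<in> phase_space S" for y
    using G(1) G(2)[OF that] g'(2)[OF that] by (simp_all add: h_def)
  have "h \<in> borel_measurable (restrict_space borel (phase_space S))"
    unfolding h_def [abs_def] using g'(1) by (rule borel_measurable_times[OF borel_measurable_const])
  moreover have "bounded (h ` phase_space S)"
    using hb(2) by (intro boundedI[where B = 1]) (elim imageE, simp only: real_norm_def)
  ultimately have h: "h \<in> Linf_plus_ball S"
    unfolding Linf_plus_ball_def Linf_plus_def using hb by blast
  have pos: "0 < \<phi> x" using assms(1) x by (simp add: leading_eigentriple_def)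
  obtain e K t\<^sub>0 where e: "0 < e" and all: "\<forall>t\<ge>t\<^sub>0. \<forall>g\<in>Linf_plus_ball S. \<forall>x\<in>phase_space S.
      \<bar>exp (- lam * t) * semigroup_op S P b t g x / \<phi> x - pairing S \<phi>' g\<bar> \<le> K * exp (- e * t)"
    using assms(1) unfolding leading_eigentriple_def by (elim conjE exE) (rule that)
  have bd: "\<bar>exp (- lam * t) * semigroup_op S P b t h x / \<phi> x - pairing S \<phi>' h\<bar> \<le> K * exp (- e * t)"
    if "t\<^sub>0 \<le> t" for t
    by (rule all[rule_format, OF that h x])
  have "((\<lambda>t. exp (- lam * t) * semigroup_op S P b t h x / \<phi> x - pairing S \<phi>' h) \<longlongrightarrow> 0) at_top"
  proof (rule Lim_null_comparison)
    show "\<forall>\<^sub>F t in at_top. norm (exp (- lam * t) * semigroup_op S P b t h x / \<phi> x - pairing S \<phi>' h)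
        \<le> K * exp (- e * t)"
      using eventually_ge_at_top[of t\<^sub>0] by eventually_elim (simp only: real_norm_def bd)
    show "((\<lambda>t. K * exp (- e * t)) \<longlongrightarrow> 0) at_top" using e by real_asymp
  qed
  then have "((\<lambda>t. exp (- lam * t) * semigroup_op S P b t h x / \<phi> x) \<longlongrightarrow> pairing S \<phi>' h) at_top"
    by (rule LIM_zero_cancel)
  from tendsto_mult[OF this tendsto_const[of "G * \<phi> x"]]
  moreover have "exp (- lam * t) * semigroup_op S P b t h x / \<phi> x * (G * \<phi> x)
      = exp (- lam * t) * semigroup_op S P b t g x" for t
    unfolding gh semigroup_op_scale using pos by simp
  moreover have "pairing S \<phi>' h * (G * \<phi> x) = pairing S \<phi>' g * \<phi> x"
    unfolding gh pairing_scale by simp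
  ultimately show ?thesis by (simp only:)
qed

text \<open>A non-integrable \<open>f\<close> has integral 0, which the nonnegative bound covers.
  The exponent of a weight is thus bounded without integrability along the path.\<close>

lemma set_integral_le_const:
  assumes "0 \<le> B" "0 \<le> t" "\<And>s. s \<in> {0..t} \<Longrightarrow> f s \<le> B"
  shows "(LINT s:{0..t}|lborel. f s) \<le> B * (t::real)"
proof (cases "set_integrable lborel {0..t} f")
  case True
  have "(LINT s:{0..t}|lborel. f s) \<le> (LINT s:{0..t}|lborel. B)"
    using True assms by (intro set_integral_mono) (auto simp: set_integrable_def)
  also have "\<dots> = B * t" using assms by (simp add: set_lebesgue_integral_def)
  finally show ?thesis .
next
  case False
  then show ?thesis
    using assms by (simp add: set_lebesgue_integral_def set_integrable_def not_integrable_integral_eq)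
qed

section \<open>Pointwise bounds and integrability of the weights\<close>

context neutron_walk
begin

lemma weight_nonneg:
  assumes "g \<in> Linf_plus S" "0 \<le> t" "z \<in> space M"
  shows "0 \<le> weight S b g t x z"
  using assms phase_point_in_phase_space[of S z x t t] x
  by (cases "ennreal t < exit_time S x z") (auto simp: weight_def space_eq Linf_plus_def)

text \<open>For positive \<open>g\<close> the survival event is the support of the weight, so a
  measurable weight makes that event measurable.\<close>

lemma weight_nonzero_iff:
  assumes "\<And>y. y \<in> phase_space S \<Longrightarrow> 0 < g y" "0 \<le> t" "z \<in> space M"
  shows "weight S b g t x z \<noteq> 0 \<longleftrightarrow> ennreal t < exit_time S x z"
  using assms phase_point_in_phase_space[of S z x t t] x
  by (cases "ennreal t < exit_time S x z") (fastforce simp: weight_def space_eq)+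

lemma weight_le:
  assumes g: "\<And>y. y \<in> phase_space S \<Longrightarrow> g y \<le> G" and "0 \<le> G"
    and b: "\<And>y. y \<in> phase_space S \<Longrightarrow> b y \<le> B" and "0 \<le> B" and t: "0 \<le> t" and z: "z \<in> space M"
  shows "weight S b g t x z \<le> exp (B * t) * G"
proof (cases "ennreal t < exit_time S x z")
  case True
  note ps = phase_point_in_phase_space[OF _ x True]
  have z: "admissible S z" using z by (simp add: space_eq)
  have "exp (LINT s:{0..t}|lborel. b (position x z s, velocity x z s)) \<le> exp (B * t)"
    using set_integral_le_const[of B t] \<open>0 \<le> B\<close> t b ps[OF z] by simp
  then have "exp (LINT s:{0..t}|lborel. b (position x z s, velocity x z s)) * g (position x z t, velocity x z t)
      \<le> exp (LINT s:{0..t}|lborel. b (position x z s, velocity x z s)) * G"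
    using g[OF ps[OF z t]] by (intro mult_left_mono) auto
  also have "\<dots> \<le> exp (B * t) * G"
    using set_integral_le_const[of B t] \<open>0 \<le> B\<close> t b ps[OF z] \<open>0 \<le> G\<close> by (intro mult_right_mono) simp_all
  finally show ?thesis using True by (simp add: weight_def)
qed (use \<open>0 \<le> G\<close> in \<open>simp add: weight_def\<close>)

text \<open>A nonzero mean certifies measurability of the weight, since the integral of a non-integrable
  function is \<open>0\<close>.\<close>

lemma weight_integrable:
  assumes g: "g \<in> Linf_plus S" and t: "0 \<le> t" and nz: "expectation (weight S (\<beta> S) g t x) \<noteq> 0"
  shows "integrable M (weight S (\<beta> S) g t x)" "integrable M (\<lambda>z. (weight S (\<beta> S) g t x z)\<^sup>2)"
proof -
  show int: "integrable M (weight S (\<beta> S) g t x)" using nz not_integrable_integral_eq by blast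
  then have [measurable]: "weight S (\<beta> S) g t x \<in> borel_measurable M" by simp
  obtain G where G: "0 < G" "\<And>y. y \<in> phase_space S \<Longrightarrow> g y \<le> G" using Linf_plus_bound[OF g] by blast
  obtain B where B: "0 \<le> B" "\<And>y. y \<in> phase_space S \<Longrightarrow> \<bar>\<beta> S y\<bar> \<le> B" using ex_beta_bound by blast
  have "weight S (\<beta> S) g t x z \<le> exp (B * t) * G" if "z \<in> space M" for z
    by (rule weight_le) (use G B t that in \<open>auto simp: abs_le_iff\<close>)
  then have "norm ((weight S (\<beta> S) g t x z)\<^sup>2) \<le> (exp (B * t) * G)\<^sup>2" if "z \<in> space M" for z
    using that weight_nonneg[OF g t] by (auto intro!: power_mono)
  then show "integrable M (\<lambda>z. (weight S (\<beta> S) g t x z)\<^sup>2)"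
    by (intro integrable_const_bound[of _ "(exp (B * t) * G)\<^sup>2"]) auto
qed

end

section \<open>Growth rates of the moments, and error and cost of the estimator\<close>

locale neutron_walk_eigen = neutron_walk S n_max x "P x"
  for S n_max x and P :: "phase \<Rightarrow> marks measure" +
  fixes lam lam\<^sub>1 :: real and \<phi> \<phi>' \<phi>\<^sub>1 \<phi>\<^sub>1' :: "phase \<Rightarrow> real"
  assumes triple: "leading_eigentriple S P (\<beta> S) lam \<phi> \<phi>'"
    and triple\<^sub>1: "leading_eigentriple S P (\<lambda>y. 2 * \<beta> S y) lam\<^sub>1 \<phi>\<^sub>1 \<phi>\<^sub>1'"
begin

lemma ex_second_moment_bound:
  assumes g: "g \<in> Linf_plus S"
  obtains K where "0 < K"
    "\<forall>\<^sub>F t in at_top. expectation (\<lambda>z. (weight S (\<beta> S) g t x z)\<^sup>2) \<le> K * exp (lam\<^sub>1 * t)"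
proof -
  define l where "l = pairing S \<phi>\<^sub>1' (\<lambda>y. (g y)\<^sup>2) * \<phi>\<^sub>1 x"
  have "\<forall>\<^sub>F t in at_top. exp (- lam\<^sub>1 * t) * semigroup_op S P (\<lambda>y. 2 * \<beta> S y) t (\<lambda>y. (g y)\<^sup>2) x < \<bar>l\<bar> + 1"
    by (rule order_tendstoD[OF leading_eigentriple_tendsto[OF triple\<^sub>1 Linf_plus_square[OF g] x]])
      (simp add: l_def)
  then have "\<forall>\<^sub>F t in at_top. expectation (\<lambda>z. (weight S (\<beta> S) g t x z)\<^sup>2) \<le> (\<bar>l\<bar> + 1) * exp (lam\<^sub>1 * t)"
    by eventually_elim (simp add: weight_sq semigroup_op_def exp_minus field_simps)
  then show thesis by (intro that[of "\<bar>l\<bar> + 1"]) auto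
qed

text \<open>Otherwise \<open>exp (- lam t) * weight S (\<beta> S) \<phi> t\<close> is bounded in \<open>L\<^sup>2\<close> and, since the walk
  exits almost surely, supported on events that shrink to a null set; but its mean is the constant
  \<open>\<phi> x > 0\<close>.\<close>

lemma growth_exponent_pos: "0 < lam\<^sub>1 - 2 * lam"
proof (rule ccontr)
  assume "\<not> 0 < lam\<^sub>1 - 2 * lam"
  then have neg: "lam\<^sub>1 - 2 * lam \<le> 0" by simp
  have \<phi>: "\<phi> \<in> Linf_plus S" "\<And>y. y \<in> phase_space S \<Longrightarrow> 0 < \<phi> y"
    and eig: "\<And>t. 0 \<le> t \<Longrightarrow> expectation (weight S (\<beta> S) \<phi> t x) = exp (lam * t) * \<phi> x"
    using triple x by (auto simp: leading_eigentriple_def semigroup_op_def)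
  obtain K where K: "0 < K"
    "\<forall>\<^sub>F t in at_top. expectation (\<lambda>z. (weight S (\<beta> S) \<phi> t x z)\<^sup>2) \<le> K * exp (lam\<^sub>1 * t)"
    using ex_second_moment_bound[OF \<phi>(1)] by blast
  then obtain t\<^sub>0 where t\<^sub>0: "\<And>t. t\<^sub>0 \<le> t \<Longrightarrow>
      expectation (\<lambda>z. (weight S (\<beta> S) \<phi> t x z)\<^sup>2) \<le> K * exp (lam\<^sub>1 * t)"
    by (auto simp: eventually_at_top_linorder)
  \<comment> \<open>An increasing sequence of times, all in the range of the moment bound and
    tending to infinity.\<close>
  define T where "T n = max 0 t\<^sub>0 + real n" for n
  have T: "0 \<le> T n" "t\<^sub>0 \<le> T n" "real n \<le> T n" for n by (auto simp: T_def)
  define X where "X n z = exp (- lam * T n) * weight S (\<beta> S) \<phi> (T n) x z" for n z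
  have nz: "expectation (weight S (\<beta> S) \<phi> (T n) x) \<noteq> 0" for n using eig[OF T(1)] \<phi>(2)[OF x] by simp
  note int = weight_integrable[OF \<phi>(1) T(1) nz]
  have "\<phi> x \<le> 0"
  proof (rule L2_bounded_vanishing_support[of X K])
    show X: "integrable (P x) (X n)" for n unfolding X_def using int by simp
    show "integrable (P x) (\<lambda>z. (X n z)\<^sup>2)" for n
      unfolding X_def power_mult_distrib using int by simp
    show "expectation (\<lambda>z. (X n z)\<^sup>2) \<le> K" for n
    proof -
      have "expectation (\<lambda>z. (X n z)\<^sup>2)
          = (exp (- lam * T n))\<^sup>2 * expectation (\<lambda>z. (weight S (\<beta> S) \<phi> (T n) x z)\<^sup>2)"
        unfolding X_def power_mult_distrib by simp
      also have "\<dots> \<le> (exp (- lam * T n))\<^sup>2 * (K * exp (lam\<^sub>1 * T n))"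
        using t\<^sub>0[OF T(2)] by (intro mult_left_mono) auto
      also have "\<dots> = K * exp ((lam\<^sub>1 - 2 * lam) * T n)"
        by (simp add: power2_eq_square exp_add[symmetric] algebra_simps)
      also have "\<dots> \<le> K * 1"
        using neg T(1) K(1) by (intro mult_left_mono) (auto simp: mult_nonpos_nonneg)
      finally show ?thesis by simp
    qed
    show "\<phi> x \<le> expectation (X n)" for n
      unfolding X_def using eig[OF T(1)] by (simp flip: exp_add mult.assoc)
    let ?A = "\<lambda>n. {z \<in> space (P x). X n z \<noteq> 0}"
    have A: "?A n = {z \<in> space (P x). ennreal (T n) < exit_time S x z}" for n
      using weight_nonzero_iff[of \<phi>, OF \<phi>(2) T(1)] by (auto simp: X_def)
    \<comment> \<open>Measurability of survival up to \<open>T n\<close> is read off from that of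
      \<open>X n\<close>.\<close>
    have meas: "?A n \<in> events" for n
    proof -
      have [measurable]: "X n \<in> borel_measurable (P x)" using X by auto
      show ?thesis by measurable
    qed
    have "(\<lambda>n. prob (?A n)) \<longlonglongrightarrow> prob (\<Inter>n. ?A n)"
    proof (rule finite_Lim_measure_decseq)
      show "decseq ?A"
      proof (rule decseq_SucI)
        fix n
        have "ennreal (T n) \<le> ennreal (T (Suc n))" by (intro ennreal_leI) (simp add: T_def)
        then show "?A (Suc n) \<subseteq> ?A n" unfolding A by (blast intro: order_le_less_trans)
      qed
    qed (use meas in auto)
    moreover have "emeasure (P x) (\<Inter>n. ?A n) = 0"
    proof (rule eternal_null)
      show "(\<Inter>n. ?A n) \<in> events" using meas by auto
      fix z assume "z \<in> (\<Inter>n. ?A n)"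
      then have *: "ennreal (T n) < exit_time S x z" for n unfolding A by auto
      show "exit_time S x z = \<infinity>"
      proof (rule ccontr)
        assume "exit_time S x z \<noteq> \<infinity>"
        then obtain e where e: "0 \<le> e" "exit_time S x z = ennreal e" by (cases "exit_time S x z") auto
        obtain n where "e \<le> real n" using real_arch_simple by blast
        also have "\<dots> \<le> T n" by (rule T)
        finally have "exit_time S x z \<le> ennreal (T n)" using e by (simp add: ennreal_leI)
        with *[of n] show False by simp
      qed
    qed
    ultimately show "(\<lambda>n. prob (?A n)) \<longlonglongrightarrow> 0" by (simp add: measure_def)
  qed
  with \<phi>(2)[OF x] show False by simp
qed

text \<open>In \<open>sample_mean_root_error\<close> the mean is eventually at least
  \<open>exp (lam * t) * (C / 2)\<close> and the second moment at most
  \<open>K * exp (lam\<^sub>1 * t)\<close>; their ratio produces the growth exponent. The strict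
  inequality for \<open>\<kappa>\<^sub>0\<close> absorbs the error in the asymptotics of the
  bias.\<close>

lemma ex_error_constants:
  assumes g: "g \<in> Linf_plus S" and pos: "0 < pairing S g \<phi>'"
    and \<kappa>\<^sub>0: "2 * (ln (pairing S \<phi>' g * \<phi> x) * exp lam)\<^sup>2 < \<kappa>\<^sub>0"
  shows "\<exists>\<kappa>\<^sub>1. error_constants S P g x lam lam\<^sub>1 \<kappa>\<^sub>1 \<kappa>\<^sub>0"
proof -
  define C where "C = pairing S \<phi>' g * \<phi> x"
  have C: "0 < C"
    using pos triple x by (simp add: C_def pairing_commute[of S g] leading_eigentriple_def)
  define m where "m t = expectation (weight S (\<beta> S) g t x)" for t
  define c where "c t = exp (- lam * t) * m t" for t
  have mc: "m t = exp (lam * t) * c t" for t by (simp add: c_def exp_minus)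
  have cC: "(c \<longlongrightarrow> C) at_top"
    using leading_eigentriple_tendsto[OF triple g x] by (simp add: c_def [abs_def] m_def semigroup_op_def C_def)
  define r where "r t = m t powr (1 / t)" for t
  have "((\<lambda>t. 2 * (t * (r t - exp lam))\<^sup>2) \<longlongrightarrow> 2 * (ln C * exp lam)\<^sup>2) at_top"
    unfolding r_def by (intro tendsto_intros powr_root_asymp[OF C cC]) (simp add: mc)
  then have ev1: "\<forall>\<^sub>F t in at_top. 2 * (t * (r t - exp lam))\<^sup>2 < \<kappa>\<^sub>0"
    by (rule order_tendstoD) (use \<kappa>\<^sub>0 in \<open>simp add: C_def\<close>)
  have ev2: "\<forall>\<^sub>F t in at_top. C / 2 < c t" by (rule order_tendstoD[OF cC]) (use C in simp)
  obtain K where K: "0 < K"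
    "\<forall>\<^sub>F t in at_top. expectation (\<lambda>z. (weight S (\<beta> S) g t x z)\<^sup>2) \<le> K * exp (lam\<^sub>1 * t)"
    using ex_second_moment_bound[OF g] by blast
  have \<kappa>\<^sub>0_pos: "0 < \<kappa>\<^sub>0" by (rule order_le_less_trans[OF _ \<kappa>\<^sub>0]) simp
  \<comment> \<open>For \<open>t \<ge> 1\<close> the bias bound keeps the root \<open>r t\<close>
    within \<open>sqrt \<kappa>\<^sub>0\<close> of \<open>exp lam\<close>, hence below
    \<open>R\<close>.\<close>
  define R where "R = exp lam + sqrt \<kappa>\<^sub>0"
  have R: "0 < R" using \<kappa>\<^sub>0_pos by (simp add: R_def add_pos_pos)
  define \<kappa>\<^sub>1 where "\<kappa>\<^sub>1 = 2 * (R / (C / 2))\<^sup>2 * K"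
  have "\<forall>\<^sub>F t in at_top. \<forall>k\<ge>1. mean_square_error S P g x lam k t
      \<le> \<kappa>\<^sub>1 / real k * exp ((lam\<^sub>1 - 2 * lam) * t) + \<kappa>\<^sub>0 / t\<^sup>2"
    using ev1 ev2 K(2) eventually_ge_at_top[of 1]
  proof eventually_elim
    case (elim t)
    have c: "0 < c t" using elim C by simp
    then have m: "0 < m t" by (simp add: mc)
    have int: "integrable (P x) (weight S (\<beta> S) g t x)"
       "integrable (P x) (\<lambda>z. (weight S (\<beta> S) g t x z)\<^sup>2)"
      using weight_integrable[OF g, of t] m elim by (auto simp: m_def)
    have sq: "2 * (r t - exp lam)\<^sup>2 \<le> \<kappa>\<^sub>0 / t\<^sup>2"
    proof -
      have "2 * (r t - exp lam)\<^sup>2 * t\<^sup>2 \<le> \<kappa>\<^sub>0"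
        using elim(1) by (simp only: power_mult_distrib mult.commute mult.left_commute)
      then show ?thesis using elim(4) by (simp add: pos_le_divide_eq)
    qed
    have "(r t - exp lam)\<^sup>2 \<le> (t * (r t - exp lam))\<^sup>2"
      using elim mult_right_mono[of 1 "t\<^sup>2" "(r t - exp lam)\<^sup>2"] by (simp add: power_mult_distrib)
    also have "\<dots> \<le> \<kappa>\<^sub>0" using elim zero_le_power2[of "t * (r t - exp lam)"] by linarith
    finally have "\<bar>r t - exp lam\<bar> \<le> sqrt \<kappa>\<^sub>0" using real_le_rsqrt[of "\<bar>r t - exp lam\<bar>" \<kappa>\<^sub>0] by simp
    then have rR: "r t \<le> R" by (simp add: R_def)
    have r0: "0 \<le> r t" by (simp add: r_def)
    show ?case
    proof (intro allI impI)
      fix k :: nat assume k: "1 \<le> k"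
      have "mean_square_error S P g x lam k t
          \<le> 2 * (r t / m t)\<^sup>2 * (expectation (\<lambda>z. (weight S (\<beta> S) g t x z)\<^sup>2) / k) + 2 * (r t - exp lam)\<^sup>2"
        unfolding mean_square_error_def estimator_def r_def m_def
        using m k elim int weight_nonneg[OF g] by (intro sample_mean_root_error) (auto simp: m_def)
      also have "\<dots> \<le> 2 * (R / (exp (lam * t) * (C / 2)))\<^sup>2 * (K * exp (lam\<^sub>1 * t) / k) + \<kappa>\<^sub>0 / t\<^sup>2"
      proof (intro add_mono sq mult_mono divide_right_mono power_mono frac_le)
        show "exp (lam * t) * (C / 2) \<le> m t" unfolding mc using elim by (intro mult_left_mono) auto
      qed (use elim R C r0 rR m in auto)
      also have "2 * (R / (exp (lam * t) * (C / 2)))\<^sup>2 * (K * exp (lam\<^sub>1 * t) / k)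
          = \<kappa>\<^sub>1 / real k * (exp (lam\<^sub>1 * t) / (exp (lam * t))\<^sup>2)"
        by (simp add: \<kappa>\<^sub>1_def power_divide power_mult_distrib mult_ac)
      also have "exp (lam\<^sub>1 * t) / (exp (lam * t))\<^sup>2 = exp ((lam\<^sub>1 - 2 * lam) * t)"
        by (simp add: exp_diff left_diff_distrib mult.assoc exp_double)
      finally show "mean_square_error S P g x lam k t
          \<le> \<kappa>\<^sub>1 / real k * exp ((lam\<^sub>1 - 2 * lam) * t) + \<kappa>\<^sub>0 / t\<^sup>2" .
    qed
  qed
  moreover have "0 < \<kappa>\<^sub>1" using R C K(1) by (simp add: \<kappa>\<^sub>1_def)
  ultimately show ?thesis
    using \<kappa>\<^sub>0_pos unfolding error_constants_def eventually_at_top_linorder by blast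
qed

text \<open>First \<open>t\<close> makes the bias term less than
  \<open>\<epsilon>\<^sup>2 / 2\<close>, then \<open>k\<close> does the same for the sampling term.
  Nothing here requires \<epsilon> to be small.\<close>

lemma ex_accurate:
  assumes ec: "error_constants S P g x lam lam\<^sub>1 \<kappa>\<^sub>1 \<kappa>\<^sub>0" and "0 < \<epsilon>"
  shows "\<exists>k\<ge>1. \<exists>t>0. mean_square_error S P g x lam k t \<le> \<epsilon>\<^sup>2"
proof -
  obtain t\<^sub>0 where \<kappa>: "0 < \<kappa>\<^sub>1" "0 < \<kappa>\<^sub>0" and t\<^sub>0: "\<And>t k. t\<^sub>0 \<le> t \<Longrightarrow> 1 \<le> k \<Longrightarrow> mean_square_error S P g x lam k t
      \<le> \<kappa>\<^sub>1 / real k * exp ((lam\<^sub>1 - 2 * lam) * t) + \<kappa>\<^sub>0 / t\<^sup>2"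
    using ec unfolding error_constants_def by blast
  have "((\<lambda>t. \<kappa>\<^sub>0 / t\<^sup>2) \<longlongrightarrow> 0) at_top" by real_asymp
  then have "\<forall>\<^sub>F t in at_top. \<kappa>\<^sub>0 / t\<^sup>2 < \<epsilon>\<^sup>2 / 2" by (rule order_tendstoD) (use assms in simp)
  then have "\<forall>\<^sub>F t in at_top. \<kappa>\<^sub>0 / t\<^sup>2 < \<epsilon>\<^sup>2 / 2 \<and> t\<^sub>0 \<le> t \<and> 0 < t"
    using eventually_ge_at_top[of t\<^sub>0] eventually_gt_at_top[of 0] by eventually_elim simp
  then obtain t where t: "\<kappa>\<^sub>0 / t\<^sup>2 < \<epsilon>\<^sup>2 / 2" "t\<^sub>0 \<le> t" "0 < t"
    by (metis (no_types, lifting) eventually_at_top_linorder order_refl)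
  define y where "y = \<kappa>\<^sub>1 * exp ((lam\<^sub>1 - 2 * lam) * t) / (\<epsilon>\<^sup>2 / 2)"
  define k where "k = nat \<lceil>y\<rceil>"
  have y: "0 < y" using \<kappa> assms by (simp add: y_def)
  then have k: "1 \<le> k" "y \<le> real k" unfolding k_def by linarith+
  have "\<kappa>\<^sub>1 / real k * exp ((lam\<^sub>1 - 2 * lam) * t) \<le> \<epsilon>\<^sup>2 / 2"
    using k assms by (simp add: y_def field_simps)
  with t(1) t\<^sub>0[OF t(2) k(1)] have "mean_square_error S P g x lam k t \<le> \<epsilon>\<^sup>2" by linarith
  with t(3) k(1) show ?thesis by blast
qed

text \<open>The expected cost is at most \<open>Q * real k\<close> uniformly in \<open>t\<close>, so
  the sample size bound transfers; \<open>Q + 1\<close> serves as a constant that is positive even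
  if \<open>Q = 0\<close>.\<close>

lemma ex_cost_bound:
  assumes ec: "error_constants S P g x lam lam\<^sub>1 \<kappa>\<^sub>1 \<kappa>\<^sub>0" and \<delta>: "0 < \<delta>"
  shows "\<exists>C>0. \<forall>\<^sub>F \<epsilon> in at_right 0. \<exists>k\<ge>1. \<exists>t>0.
     mean_square_error S P g x lam k t \<le> \<epsilon>\<^sup>2 \<and>
     (\<integral>\<^sup>+z. cost S k t x z \<partial>P x) \<le> ennreal (C * exp ((lam\<^sub>1 - 2 * lam) * sqrt (\<kappa>\<^sub>0 + \<delta>) / \<epsilon>))"
proof -
  obtain t\<^sub>0 where \<kappa>: "0 < \<kappa>\<^sub>1" "0 < \<kappa>\<^sub>0" and t\<^sub>0: "\<And>t k. t\<^sub>0 \<le> t \<Longrightarrow> 1 \<le> k \<Longrightarrow> mean_square_error S P g x lam k t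
      \<le> \<kappa>\<^sub>1 / real k * exp ((lam\<^sub>1 - 2 * lam) * t) + \<kappa>\<^sub>0 / t\<^sup>2"
    using ec unfolding error_constants_def by blast
  obtain Q where Q: "0 \<le> Q" "\<And>k t. (\<integral>\<^sup>+z. cost S k t x z \<partial>P x) \<le> ennreal (Q * real k)"
    using ex_scatter_cost_bound by blast
  have "\<forall>\<^sub>F \<epsilon> in at_right 0. \<exists>k\<ge>1. \<exists>t>0. mean_square_error S P g x lam k t \<le> \<epsilon>\<^sup>2 \<and>
     (\<integral>\<^sup>+z. cost S k t x z \<partial>P x)
       \<le> ennreal ((Q + 1) * exp ((lam\<^sub>1 - 2 * lam) * sqrt (\<kappa>\<^sub>0 + \<delta>) / \<epsilon>))"
    using sample_size_bound[OF growth_exponent_pos \<kappa> \<delta>, of t\<^sub>0]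
  proof eventually_elim
    case (elim \<epsilon>)
    then obtain k t where kt: "1 \<le> k" "0 < t" "t\<^sub>0 \<le> t"
      "\<kappa>\<^sub>1 / real k * exp ((lam\<^sub>1 - 2 * lam) * t) + \<kappa>\<^sub>0 / t\<^sup>2 \<le> \<epsilon>\<^sup>2"
      "real k \<le> exp ((lam\<^sub>1 - 2 * lam) * sqrt (\<kappa>\<^sub>0 + \<delta>) / \<epsilon>)" by blast
    have "Q * real k \<le> (Q + 1) * exp ((lam\<^sub>1 - 2 * lam) * sqrt (\<kappa>\<^sub>0 + \<delta>) / \<epsilon>)"
      using Q(1) kt(5) by (intro mult_mono) auto
    then have "(\<integral>\<^sup>+z. cost S k t x z \<partial>P x)
        \<le> ennreal ((Q + 1) * exp ((lam\<^sub>1 - 2 * lam) * sqrt (\<kappa>\<^sub>0 + \<delta>) / \<epsilon>))"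
      using Q(2)[of k t] ennreal_leI order_trans by blast
    moreover have "mean_square_error S P g x lam k t \<le> \<epsilon>\<^sup>2" using t\<^sub>0[OF kt(3,1)] kt(4) by linarith
    ultimately show ?case using kt(1,2) by blast
  qed
  moreover have "0 < Q + 1" using Q(1) by simp
  ultimately show ?thesis by blast
qed

end

theorem corollary6p3:
  fixes S :: transport and n_max :: real and P :: "phase \<Rightarrow> marks measure"
    and lam lam\<^sub>1 :: real and \<phi> \<phi>' \<phi>\<^sub>1 \<phi>\<^sub>1' g :: "phase \<Rightarrow> real" and x :: phase
  assumes "transport_assms S n_max"
    and "\<And>y. y \<in> phase_space S \<Longrightarrow> nrw_law S y (P y)"
    and "leading_eigentriple S P (\<beta> S) lam \<phi> \<phi>'"
    and "leading_eigentriple S P (\<lambda>y. 2 * \<beta> S y) lam\<^sub>1 \<phi>\<^sub>1 \<phi>\<^sub>1'"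
    and "g \<in> Linf_plus S" and "0 < pairing S g \<phi>'" and "x \<in> phase_space S"
  shows
    "(\<forall>\<epsilon>>0. \<exists>k\<ge>1. \<exists>t>0. mean_square_error S P g x lam k t \<le> \<epsilon>\<^sup>2) \<and>
     (\<exists>\<kappa>\<^sub>1 \<kappa>\<^sub>0. error_constants S P g x lam lam\<^sub>1 \<kappa>\<^sub>1 \<kappa>\<^sub>0) \<and>
     (let C\<^sub>0 = pairing S \<phi>' g * \<phi> x in
        C\<^sub>0 \<noteq> 1 \<longrightarrow>
        (\<forall>\<eta>>0. \<exists>\<kappa>\<^sub>1. error_constants S P g x lam lam\<^sub>1 \<kappa>\<^sub>1 (2 * (ln C\<^sub>0 * exp lam)\<^sup>2 + \<eta>))) \<and>
     (\<forall>\<kappa>\<^sub>1 \<kappa>\<^sub>0. error_constants S P g x lam lam\<^sub>1 \<kappa>\<^sub>1 \<kappa>\<^sub>0 \<longrightarrow>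
        (\<forall>\<delta>>0. \<exists>C>0. \<forall>\<^sub>F \<epsilon> in at_right 0. \<exists>k\<ge>1. \<exists>t>0.
           mean_square_error S P g x lam k t \<le> \<epsilon>\<^sup>2 \<and>
           (\<integral>\<^sup>+z. cost S k t x z \<partial>P x)
             \<le> ennreal (C * exp ((lam\<^sub>1 - 2 * lam) * sqrt (\<kappa>\<^sub>0 + \<delta>) / \<epsilon>))) \<and>
        (\<forall>\<^sub>F \<epsilon> in at_right 0. \<exists>k t. optimal (lam\<^sub>1 - 2 * lam) \<kappa>\<^sub>1 \<kappa>\<^sub>0 \<epsilon> k t) \<and>
        (\<forall>k t. (\<forall>\<^sub>F \<epsilon> in at_right 0. optimal (lam\<^sub>1 - 2 * lam) \<kappa>\<^sub>1 \<kappa>\<^sub>0 \<epsilon> (k \<epsilon>) (t \<epsilon>)) \<longrightarrow>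
           t \<sim>[at_right 0] (\<lambda>\<epsilon>. sqrt \<kappa>\<^sub>0 / \<epsilon>) \<and>
           k \<sim>[at_right 0] (\<lambda>\<epsilon>. (lam\<^sub>1 - 2 * lam) * sqrt \<kappa>\<^sub>0 * \<kappa>\<^sub>1 * exp ((lam\<^sub>1 - 2 * lam) * t \<epsilon>)
                                   / (2 * \<epsilon> ^ 3))))"
proof -
  interpret neutron_walk_eigen S n_max x P lam lam\<^sub>1 \<phi> \<phi>' \<phi>\<^sub>1 \<phi>\<^sub>1'
    using assms by unfold_locales auto
  note constants = ex_error_constants[OF assms(5,6)]
  \<comment> \<open>Here \<open>less_add_one\<close> takes \<open>\<kappa>\<^sub>0\<close> one above
    the threshold, which also covers the case where the limit constant is 1.\<close>
  obtain \<kappa>\<^sub>1 \<kappa>\<^sub>0 where \<kappa>: "error_constants S P g x lam lam\<^sub>1 \<kappa>\<^sub>1 \<kappa>\<^sub>0"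
    using constants[OF less_add_one] by blast
  note pos = growth_exponent_pos
  have small: "\<forall>\<^sub>F \<epsilon> in at_right (0::real). 0 < \<epsilon>" by (simp add: eventually_at_right_less)
  show ?thesis
    unfolding Let_def
  proof (intro conjI allI impI)
    fix \<kappa>\<^sub>1 \<kappa>\<^sub>0 assume ec: "error_constants S P g x lam lam\<^sub>1 \<kappa>\<^sub>1 \<kappa>\<^sub>0"
    then have k: "0 < \<kappa>\<^sub>1" "0 < \<kappa>\<^sub>0" by (auto simp: error_constants_def)
    show "\<forall>\<^sub>F \<epsilon> in at_right 0. \<exists>k t. optimal (lam\<^sub>1 - 2 * lam) \<kappa>\<^sub>1 \<kappa>\<^sub>0 \<epsilon> k t"
      using small by eventually_elim (rule ex_optimal[OF pos k])
    fix k t assume "\<forall>\<^sub>F \<epsilon> in at_right 0. optimal (lam\<^sub>1 - 2 * lam) \<kappa>\<^sub>1 \<kappa>\<^sub>0 \<epsilon> (k \<epsilon>) (t \<epsilon>)"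
    from optimal_asymp[OF pos k this]
    show "t \<sim>[at_right 0] (\<lambda>\<epsilon>. sqrt \<kappa>\<^sub>0 / \<epsilon>)"
      "k \<sim>[at_right 0] (\<lambda>\<epsilon>. (lam\<^sub>1 - 2 * lam) * sqrt \<kappa>\<^sub>0 * \<kappa>\<^sub>1 * exp ((lam\<^sub>1 - 2 * lam) * t \<epsilon>) / (2 * \<epsilon> ^ 3))" .
  qed (use \<kappa> ex_accurate[OF \<kappa>] ex_cost_bound constants in \<open>auto\<close>)
qed

end
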